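(* For every positive integer $n$, $P^{\ltimes n}\subset\mathbb{R}^{2n}$ is a symplectically self-polar convex polytope, and: (1) its volume is $$\operatorname{vol} P^{\ltimes n}=\frac{2^n}{n!}\cdot\frac{\Gamma\left(n+\frac34\right)}{\Gamma\left(n+\frac12\right)}\cdot\frac{\Gamma\left(\frac12\right)}{\Gamma\left(\frac34\right)},$$ where $\Gamma$ is the gamma function; (2) its number of vertices is $|V(P^{\ltimes n})|=10\cdot(2^{n-1}-1)+6$; (3) its affine cylindrical capacity is $c_{ZA}(P^{\ltimes n})=3$.
   Context: $\omega$ is the standard symplectic form: on $\mathbb{R}^2$, $\omega((x,y),(x',y'))=xy'-yx'$; $\mathbb{R}^{2n}$ is the direct sum of $n$ copies of $\mathbb{R}^2$ and $\omega$ is the sum of the forms of the copies. In particular $\mathbb{R}^{2n+2}\cong\mathbb{R}^2\times\mathbb{R}^{2n}$ with $\omega((a,b),(a',b'))=\omega(a,a')+\omega(b,b')$, and the first two coordinates of $\mathbb{R}^{2n}$ span a symplectic plane (the first copy of $\mathbb{R}^2$). For a convex set $X\subset\mathbb{R}^{2n}$, $X^\omega=\{y\in\mathbb{R}^{2n}: \omega(x,y)\le 1\ \forall x\in X\}$. A convex body (compact convex set) $X$ with the origin in its interior is symplectically self-polar if $X=X^\omega$. $P=\operatorname{conv}\{\pm(1,1),\pm(1,0),\pm(0,1)\}\subset\mathbb{R}^2$ and $e=(1,1)\in P$. For a centrally symmetric convex body $X\subset\mathbb{R}^{2n}$ (with nonempty interior), $\|\cdot\|_X$ is the norm with unit ball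 $X$, and the symplectic $P$-suspension of $X$ is $$P\ltimes_\omega X=\{(v_1,v_2)\in P\times\mathbb{R}^{2n}: |\omega(e,v_1)|+\|v_2\|_X\le 1\}\subset\mathbb{R}^{2n+2}.$$ Define $P^{\ltimes 1}=P$ and $P^{\ltimes n}=P\ltimes_\omega P^{\ltimes (n-1)}$ for $n>1$. $V(K)$ denotes the set of vertices of a polytope $K$. The affine cylindrical capacity of a convex body $X\subset\mathbb{R}^{2n}$ is $c_{ZA}(X)=\inf_\varphi \operatorname{vol}\pi(\varphi(X))$, where the infimum is over all linear symplectomorphisms $\varphi$ of $\mathbb{R}^{2n}$ and $\pi:\mathbb{R}^{2n}\to\mathbb{R}^2$ is the orthogonal projection onto the first two coordinates (the volume being the area in $\mathbb{R}^2$). *)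

theory Defs
  imports "HOL-Analysis.Analysis" "HOL-Library.Function_Algebras"
begin

text \<open>
  The space of dimension \<open>m\<close> is the carrier of the library's \<^const>\<open>Euclidean_space\<close> \<open>m\<close>: the
  sequences \<open>nat \<Rightarrow> real\<close> that vanish at all indices \<open>\<ge> m\<close>, with the product topology. The
  pointwise vector space structure below makes the library's convex hulls, polytopes, extreme
  points and linear maps applicable for every dimension at once.
\<close>

instantiation "fun" :: (type, real_vector) real_vector
begin

definition "scaleR c f = (\<lambda>x. c *\<^sub>R f x)"

instance
  by standard
    (simp_all add: scaleR_fun_def fun_eq_iff scaleR_add_right scaleR_add_left)

end

abbreviation R2n :: "nat \<Rightarrow> (nat \<Rightarrow> real) set" where
  "R2n n \<equiv> topspace (Euclidean_space (2 * n))"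

text \<open>The coordinates \<open>2 * i\<close> and \<open>2 * i + 1\<close> belong to the \<open>i\<close>-th copy of the plane.\<close>

definition omega :: "nat \<Rightarrow> (nat \<Rightarrow> real) \<Rightarrow> (nat \<Rightarrow> real) \<Rightarrow> real" where
  "omega n x y = (\<Sum>i<n. x (2 * i) * y (2 * i + 1) - x (2 * i + 1) * y (2 * i))"

definition omega_polar :: "nat \<Rightarrow> (nat \<Rightarrow> real) set \<Rightarrow> (nat \<Rightarrow> real) set" where
  "omega_polar n X = {y \<in> R2n n. \<forall>x\<in>X. omega n x y \<le> 1}"

definition symplectically_self_polar :: "nat \<Rightarrow> (nat \<Rightarrow> real) set \<Rightarrow> bool" where
  "symplectically_self_polar n X \<longleftrightarrow>
     convex X \<and> compactin (Euclidean_space (2 * n)) X \<and>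
     0 \<in> Euclidean_space (2 * n) interior_of X \<and>
     X = omega_polar n X"

definition plane_vec :: "real \<Rightarrow> real \<Rightarrow> nat \<Rightarrow> real" where
  "plane_vec a b = (\<lambda>i. if i = 0 then a else if i = 1 then b else 0)"

definition P :: "(nat \<Rightarrow> real) set" where
  "P = convex hull {plane_vec 1 1, - plane_vec 1 1, plane_vec 1 0, - plane_vec 1 0,
                    plane_vec 0 1, - plane_vec 0 1}"

definition e :: "nat \<Rightarrow> real" where
  "e = plane_vec 1 1"

text \<open>
  The norm with unit ball \<open>X\<close>, for \<open>X\<close> a centrally symmetric convex body with nonempty interior.
\<close>

definition body_norm :: "(nat \<Rightarrow> real) set \<Rightarrow> (nat \<Rightarrow> real) \<Rightarrow> real" where
  "body_norm X v = Inf {t. 0 < t \<and> v \<in> (\<lambda>x. t *\<^sub>R x) ` X}"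

text \<open>The identification of pairs (vector of the plane, further vector) with vectors.\<close>

definition join :: "(nat \<Rightarrow> real) \<Rightarrow> (nat \<Rightarrow> real) \<Rightarrow> nat \<Rightarrow> real" where
  "join v1 v2 = (\<lambda>i. if i < 2 then v1 i else v2 (i - 2))"

definition P_suspension :: "nat \<Rightarrow> (nat \<Rightarrow> real) set \<Rightarrow> (nat \<Rightarrow> real) set" where
  "P_suspension n X =
     {join v1 v2 | v1 v2. v1 \<in> P \<and> v2 \<in> R2n n \<and> \<bar>omega 1 e v1\<bar> + body_norm X v2 \<le> 1}"

text \<open>The value at \<open>0\<close> is a dummy: the iterated suspension is only meant for positive \<open>n\<close>.\<close>

fun P_power :: "nat \<Rightarrow> (nat \<Rightarrow> real) set" where
  "P_power 0 = {0}"
| "P_power (Suc 0) = P"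
| "P_power (Suc (Suc n)) = P_suspension (Suc n) (P_power (Suc n))"

text \<open>
  Volume of a subset of \<^term>\<open>R2n n\<close>. The elements of a product measure space over \<open>{..<2 * n}\<close>
  are functions that are \<^const>\<open>undefined\<close> outside the index set, hence the restriction.
\<close>

definition vol :: "nat \<Rightarrow> (nat \<Rightarrow> real) set \<Rightarrow> real" where
  "vol n X = measure (PiM {..<2 * n} (\<lambda>_. lborel)) ((\<lambda>x. restrict x {..<2 * n}) ` X)"

definition vertices :: "(nat \<Rightarrow> real) set \<Rightarrow> (nat \<Rightarrow> real) set" where
  "vertices K = {v. v extreme_point_of K}"

text \<open>
  Only the values on \<^term>\<open>R2n n\<close> matter; requiring linearity on all sequences is no
  restriction, since every linear map on a subspace extends linearly.
\<close>

definition linear_symplectomorphism :: "nat \<Rightarrow> ((nat \<Rightarrow> real) \<Rightarrow> (nat \<Rightarrow> real)) \<Rightarrow> bool" where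
  "linear_symplectomorphism n \<phi> \<longleftrightarrow>
     linear \<phi> \<and> bij_betw \<phi> (R2n n) (R2n n) \<and>
     (\<forall>x\<in>R2n n. \<forall>y\<in>R2n n. omega n (\<phi> x) (\<phi> y) = omega n x y)"

definition plane_proj :: "(nat \<Rightarrow> real) \<Rightarrow> nat \<Rightarrow> real" where
  "plane_proj x = (\<lambda>i. if i < 2 then x i else 0)"

definition c_ZA :: "nat \<Rightarrow> (nat \<Rightarrow> real) set \<Rightarrow> real" where
  "c_ZA n X = (INF \<phi>\<in>{\<phi>. linear_symplectomorphism n \<phi>}. vol 1 (plane_proj ` \<phi> ` X))"

end

theory Submission
  imports Defs
begin

text \<open>
  The iterated suspension is the unit ball of an explicit norm, defined by recursion on the
  dimension. Self-polarity is the statement that this norm is its own dual under the symplectic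
  form, which reduces to an inequality in the plane. Splitting off the first plane also gives the
  vertices (four new ones, and two copies of the old ones over the two signs of \<open>(1, 1)\<close>) and the
  volume (integrate \<open>(1 - \<bar>a - b\<bar>)\<close> to the power of the dimension over the hexagon).

  For the capacity, the projection \<open>K\<close> of a symplectic image of a self-polar body to a symplectic
  plane contains its own polar in that plane, because that polar is a section of the image. A
  symmetric planar body with this property has area at least 3: inscribe an affine regular hexagon
  in \<open>K\<close>; whatever its area lacks is found in the triangles that \<open>K\<close> has to contain outside its
  edges. The identity attains the bound, since there \<open>K\<close> is the hexagon \<open>P\<close>.
\<close>

subsection \<open>Planar bodies that contain their polar\<close>

text \<open>The symplectic form of one plane, taken on \<open>real^2\<close> so that triangle areas,
  frontiers and Lebesgue measure are at hand.\<close>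

definition det2 :: "real^2 \<Rightarrow> real^2 \<Rightarrow> real" where
  "det2 u v = u $ 1 * v $ 2 - u $ 2 * v $ 1"

text \<open>For \<open>det2 p q > 0\<close> this is the sector swept counterclockwise from
  \<open>p\<close> to \<open>q\<close>. Leaving out the bounding rays makes adjacent sectors
  disjoint, so that their areas add up.\<close>

definition open_cone :: "real^2 \<Rightarrow> real^2 \<Rightarrow> (real^2) set" where
  "open_cone p q = {x. det2 p x > 0 \<and> det2 x q > 0}"

lemma det2_linear [simp]:
  "det2 (u + v) w = det2 u w + det2 v w" "det2 w (u + v) = det2 w u + det2 w v"
  "det2 (u - v) w = det2 u w - det2 v w" "det2 w (u - v) = det2 w u - det2 w v"
  "det2 (c *\<^sub>R u) w = c * det2 u w" "det2 w (c *\<^sub>R u) = c * det2 w u"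
  "det2 (- u) w = - det2 u w" "det2 w (- u) = - det2 w u"
  "det2 0 w = 0" "det2 w 0 = 0" "det2 u u = 0"
  by (simp_all add: det2_def algebra_simps)

lemma det2_swap: "det2 u v = - det2 v u"
  by (simp add: det2_def)

lemma continuous_on_det2 [continuous_intros]: "continuous_on S (det2 u)"
  "continuous_on S (\<lambda>x. det2 x u)"
  unfolding det2_def by (intro continuous_intros)+

lemma open_cone_borel [measurable]: "open_cone p q \<in> sets borel"
proof -
  have "open (open_cone p q)"
    unfolding open_cone_def Collect_conj_eq
    by (intro open_Int open_Collect_less continuous_intros)
  then show ?thesis by simp
qed

lemma det2_cramer: "det2 p q *\<^sub>R z = det2 z q *\<^sub>R p + det2 p z *\<^sub>R q"
  by (simp add: vec_eq_iff forall_2 det2_def algebra_simps)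

lemma negligible_det2_eq_0:
  assumes "p \<noteq> 0" shows "negligible {x. det2 p x = 0}"
proof -
  define a :: "real^2" where "a = vector [- (p $ 2), p $ 1]"
  have "a \<noteq> 0" using assms by (auto simp: a_def vec_eq_iff forall_2)
  moreover have "det2 p x = a \<bullet> x" for x
    by (simp add: a_def det2_def inner_vec_def sum_2)
  ultimately show ?thesis using negligible_hyperplane[of a 0] by simp
qed

lemma measure_disjoint_sum_le:
  assumes "A \<in> sets M" "B \<in> sets M" "A \<inter> B = {}" "A \<union> B \<subseteq> C" "C \<in> fmeasurable M"
  shows "measure M A + measure M B \<le> measure M C"
proof -
  have "A \<in> fmeasurable M" "B \<in> fmeasurable M"
    using assms by (auto intro: fmeasurableI2)
  then have "measure M A + measure M B = measure M (A \<union> B)"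
    using assms(3) by (metis measure_Un3 Int_commute diff_zero measure_empty)
  also have "\<dots> \<le> measure M C"
    using assms by (intro measure_mono_fmeasurable) auto
  finally show ?thesis .
qed

lemma compact_Int_fmeasurable:
  fixes K :: "'a::euclidean_space set"
  assumes "compact K" "S \<in> sets borel" shows "K \<inter> S \<in> fmeasurable lborel"
  using fmeasurable_compact[OF assms(1)] assms(2) by (intro fmeasurable_Int_fmeasurable) auto

context
  fixes K :: "(real^2) set"
  assumes compact: "compact K" and convex: "convex K"
begin

text \<open>By convexity \<open>K\<close> contains the triangle \<open>0, p, q\<close>; only its
  points on the two rays through \<open>p\<close> and \<open>q\<close> fall outside the open sector,
  and they form a null set.\<close>

lemma open_cone_area:
  assumes "0 \<in> K" "p \<in> K" "q \<in> K" and "det2 p q \<ge> 0"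
  shows "det2 p q / 2 \<le> measure lborel (K \<inter> open_cone p q)"
proof (cases "det2 p q = 0")
  case False
  then have pos: "det2 p q > 0" using assms by simp
  then have "p \<noteq> 0" "q \<noteq> 0" by auto
  let ?T = "convex hull {0, p, q}" and ?N = "{x. det2 p x = 0} \<union> {x. det2 q x = 0}"
  have null: "?N \<in> null_sets lebesgue"
    using negligible_det2_eq_0 \<open>p \<noteq> 0\<close> \<open>q \<noteq> 0\<close> by (simp add: negligible_iff_null_sets[symmetric])
  have TK: "?T \<subseteq> K" using assms convex by (intro hull_minimal) auto
  have sub: "?T - ?N \<subseteq> K \<inter> open_cone p q"
  proof
    fix x assume x: "x \<in> ?T - ?N"
    then obtain u v w where uvw: "0 \<le> u" "0 \<le> v" "0 \<le> w" "x = u *\<^sub>R 0 + v *\<^sub>R p + w *\<^sub>R q"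
      unfolding convex_hull_3 by blast
    have "det2 p x = w * det2 p q" "det2 x q = v * det2 p q"
      using uvw by simp_all
    moreover have "det2 p x \<noteq> 0" "det2 x q \<noteq> 0" using x det2_swap[of q x] by auto
    ultimately show "x \<in> K \<inter> open_cone p q"
      using uvw pos x TK by (auto simp: open_cone_def zero_less_mult_iff)
  qed
  have compT: "compact ?T" by (simp add: compact_convex_hull finite_imp_compact)
  then have "measure lborel ?T = measure lebesgue ?T"
    by (simp add: measure_completion compact_imp_closed)
  also have "\<dots> = measure lebesgue (?T - ?N)"
    using compT null by (metis fmeasurableD lmeasurable_compact measure_Diff_null_set)
  also have "\<dots> \<le> measure lebesgue (K \<inter> open_cone p q)"
  proof (rule measure_mono_fmeasurable[OF sub])
    show "?T - ?N \<in> sets lebesgue"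
      using compT null by (metis fmeasurableD lmeasurable_compact null_setsD2 sets.Diff)
    show "K \<inter> open_cone p q \<in> lmeasurable"
      using compact by (intro fmeasurable_Int_fmeasurable lmeasurable_compact) auto
  qed
  also have "\<dots> = measure lborel (K \<inter> open_cone p q)"
    using compact by (intro measure_completion) (simp add: compact_imp_closed)
  also have "measure lborel ?T = det2 p q / 2"
    using pos content_triangle[of 0 p q] by (simp add: det2_def mult.commute abs_minus_commute)
  finally show ?thesis .
qed simp

text \<open>The sign conditions put \<open>z\<close> into the closed sector, and the bound is the
  total area of the triangles \<open>0, p, z\<close> and \<open>0, z, q\<close>.\<close>

lemma quadrilateral_area:
  assumes "0 \<in> K" "p \<in> K" "q \<in> K" "z \<in> K"
    and "det2 p q > 0" "det2 p z \<ge> 0" "det2 z q \<ge> 0"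
  shows "det2 z (q - p) / 2 \<le> measure lborel (K \<inter> open_cone p q)"
proof -
  have sub: "x \<in> open_cone p q" if "x \<in> open_cone p z \<union> open_cone z q" for x
  proof -
    \<comment> \<open>Cramer's rule paired with \<open>q\<close> or with \<open>p\<close>: for
      \<open>x\<close> in either subsector the missing determinant becomes a sum of nonnegative
      terms, one of them positive.\<close>
    have c1: "det2 p z * det2 x q = det2 x z * det2 p q + det2 p x * det2 z q"
      using arg_cong[OF det2_cramer[of p z x], of "\<lambda>y. det2 y q"] by simp
    have c2: "det2 z q * det2 p x = det2 x q * det2 p z + det2 z x * det2 p q"
      using arg_cong[OF det2_cramer[of z q x], of "det2 p"] by simp
    from that show ?thesis
    proof
      assume "x \<in> open_cone p z"
      then have "det2 p x > 0" "det2 x z > 0" by (auto simp: open_cone_def)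
      moreover from this have "det2 p z * det2 x q > 0"
        unfolding c1 using assms by (intro add_pos_nonneg) auto
      ultimately show ?thesis using assms by (auto simp: open_cone_def zero_less_mult_iff)
    next
      assume "x \<in> open_cone z q"
      then have "det2 z x > 0" "det2 x q > 0" by (auto simp: open_cone_def)
      moreover from this have "det2 z q * det2 p x > 0"
        unfolding c2 using assms by (intro add_nonneg_pos) auto
      ultimately show ?thesis using assms by (auto simp: open_cone_def zero_less_mult_iff)
    qed
  qed
  have "measure lborel (K \<inter> open_cone p z) + measure lborel (K \<inter> open_cone z q)
      \<le> measure lborel (K \<inter> open_cone p q)"
  proof (rule measure_disjoint_sum_le)
    show "(K \<inter> open_cone p z) \<inter> (K \<inter> open_cone z q) = {}"
      using det2_swap[of z] by (auto simp: open_cone_def)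
  qed (use sub compact in \<open>auto simp: compact_imp_closed intro!: compact_Int_fmeasurable\<close>)
  moreover have "det2 p z / 2 \<le> measure lborel (K \<inter> open_cone p z)"
    "det2 z q / 2 \<le> measure lborel (K \<inter> open_cone z q)"
    using assms by (intro open_cone_area; simp)+
  ultimately show ?thesis using det2_swap[of z p] by (simp add: field_simps)
qed

text \<open>If \<open>det2 p q \<ge> 1\<close>, the triangle \<open>0, p, q\<close> is large enough.
  Otherwise \<open>z\<close> lies beyond the line through \<open>p\<close> and \<open>q\<close>;
  since \<open>K\<close> does not extend past \<open>p\<close> and \<open>q\<close> on their rays,
  \<open>z\<close> must lie in the sector, and the quadrilateral \<open>0, p, z, q\<close> has the
  required area.\<close>

lemma sector_area:
  assumes "0 \<in> K" "p \<in> K" "q \<in> K" "det2 p q > 0"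
    and bd: "\<And>r. r > 1 \<Longrightarrow> r *\<^sub>R p \<notin> K" "\<And>r. r > 1 \<Longrightarrow> r *\<^sub>R q \<notin> K"
    and z: "z \<in> K" "det2 z (q - p) \<ge> 1"
  shows "1 / 2 \<le> measure lborel (K \<inter> open_cone p q)"
proof (cases "det2 p q \<ge> 1")
  case True
  then show ?thesis using open_cone_area[of p q] assms by simp
next
  case False
  define s where "s = det2 z q / det2 p q"
  define t where "t = det2 p z / det2 p q"
  have "det2 p q *\<^sub>R z = det2 p q *\<^sub>R (s *\<^sub>R p + t *\<^sub>R q)"
    using det2_cramer[of p q z] assms(4) by (simp add: s_def t_def algebra_simps)
  then have zst: "z = s *\<^sub>R p + t *\<^sub>R q" using assms(4) by simp
  \<comment> \<open>The left side is \<open>det2 z (q - p)\<close>. Divided by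
    \<open>det2 p q\<close>, the inequality says that the coordinates of \<open>z\<close> satisfy
    \<open>s + t > 1\<close>.\<close>
  have "det2 z q + det2 p z > det2 p q"
    using z False det2_swap[of z p] by simp
  then have st: "s + t > 1" using assms(4) by (simp add: s_def t_def field_simps)
  \<comment> \<open>For \<open>s < 0\<close> the segment from \<open>z\<close> to \<open>p\<close>
    meets the ray of \<open>q\<close> at the factor \<open>t / (1 - s) > 1\<close>, which
    \<open>bd\<close> forbids. The argument for \<open>t\<close> is the mirror image.\<close>
  have "s \<ge> 0"
  proof (rule ccontr)
    assume "\<not> s \<ge> 0"
    then have "(1 / (1 - s)) *\<^sub>R z + (- s / (1 - s)) *\<^sub>R p \<in> K"
      using assms by (intro convexD[OF convex]) (auto simp: field_simps)
    moreover have "(1 / (1 - s)) *\<^sub>R z + (- s / (1 - s)) *\<^sub>R p = (t / (1 - s)) *\<^sub>R q"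
      by (simp add: zst algebra_simps)
    ultimately show False using bd(2)[of "t / (1 - s)"] st \<open>\<not> s \<ge> 0\<close> by simp
  qed
  moreover have "t \<ge> 0"
  proof (rule ccontr)
    assume "\<not> t \<ge> 0"
    then have "(1 / (1 - t)) *\<^sub>R z + (- t / (1 - t)) *\<^sub>R q \<in> K"
      using assms by (intro convexD[OF convex]) (auto simp: field_simps)
    moreover have "(1 / (1 - t)) *\<^sub>R z + (- t / (1 - t)) *\<^sub>R q = (s / (1 - t)) *\<^sub>R p"
      by (simp add: zst algebra_simps)
    ultimately show False using bd(1)[of "s / (1 - t)"] st \<open>\<not> t \<ge> 0\<close> by simp
  qed
  ultimately have "det2 p z \<ge> 0" "det2 z q \<ge> 0"
    using assms(4) by (simp_all add: s_def t_def zero_le_divide_iff)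
  then show ?thesis using quadrilateral_area[of p q z] assms by simp
qed

end

text \<open>The rays through \<open>a\<close>, \<open>b\<close>, \<open>b - a\<close>,
  \<open>- a\<close> cut the half plane into three sectors, and each contributes 1/2 by
  \<open>sector_area\<close>.\<close>

lemma half_hexagon_area:
  fixes K :: "(real^2) set"
  assumes "compact K" "convex K" and sym: "\<And>x. x \<in> K \<Longrightarrow> - x \<in> K"
    and K: "0 \<in> K" "a \<in> K" "b \<in> K" "b - a \<in> K" and pos: "det2 a b > 0"
    and bd: "\<And>u r. u \<in> {a, b, b - a} \<Longrightarrow> r > 1 \<Longrightarrow> r *\<^sub>R u \<notin> K"
    and wide: "\<And>u. u \<in> {a, b, b - a} \<Longrightarrow> \<exists>z\<in>K. det2 z u \<ge> 1"
  shows "3 / 2 \<le> measure lborel (K \<inter> {x. det2 a x > 0})"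
proof -
  note area = sector_area[OF \<open>compact K\<close> \<open>convex K\<close> \<open>0 \<in> K\<close>]
  have bda: "r *\<^sub>R - a \<notin> K" if "r > 1" for r
    using bd[of a r] sym[of "r *\<^sub>R - a"] that by auto
  obtain z where "z \<in> K" "det2 z (b - a) \<ge> 1" using wide by blast
  then have 1: "1 / 2 \<le> measure lborel (K \<inter> open_cone a b)"
    using K pos bd by (intro area[of a b z]) auto
  \<comment> \<open>The hexagon edges belonging to the second and third sector are
    \<open>- a\<close> and \<open>- b\<close>, hence the point enters as \<open>- z\<close>.\<close>
  obtain z where "z \<in> K" "det2 z a \<ge> 1" using wide by blast
  then have 2: "1 / 2 \<le> measure lborel (K \<inter> open_cone b (b - a))"
    using K pos bd sym det2_swap[of b a] by (intro area[of b "b - a" "- z"]) auto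
  obtain z where "z \<in> K" "det2 z b \<ge> 1" using wide by blast
  then have 3: "1 / 2 \<le> measure lborel (K \<inter> open_cone (b - a) (- a))"
    using K pos bd bda sym det2_swap[of b a] by (intro area[of "b - a" "- a" "- z"]) auto
  have halfplane: "{x. det2 a x > 0} \<in> sets borel"
    by (intro borel_open open_Collect_less continuous_intros)
  have [simp]: "K \<in> sets borel" using \<open>compact K\<close> by (simp add: compact_imp_closed)
  note fm = compact_Int_fmeasurable[OF \<open>compact K\<close>]
  have a_pos: "det2 a x > 0" if "x \<in> open_cone a b \<union> open_cone b (b - a) \<union> open_cone (b - a) (- a)" for x
    using that det2_swap[of x] by (auto simp: open_cone_def)
  have "measure lborel (K \<inter> open_cone a b) + measure lborel (K \<inter> open_cone b (b - a))
      \<le> measure lborel (K \<inter> open_cone a b \<union> K \<inter> open_cone b (b - a))"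
  proof (rule measure_disjoint_sum_le)
    have "x \<notin> open_cone a b" if "x \<in> open_cone b (b - a)" for x
      using that det2_swap[of x] by (auto simp: open_cone_def)
    then show "(K \<inter> open_cone a b) \<inter> (K \<inter> open_cone b (b - a)) = {}"
      by blast
  qed (auto intro!: fmeasurable.Un fm)
  moreover have "measure lborel (K \<inter> open_cone a b \<union> K \<inter> open_cone b (b - a))
       + measure lborel (K \<inter> open_cone (b - a) (- a)) \<le> measure lborel (K \<inter> {x. det2 a x > 0})"
  proof (rule measure_disjoint_sum_le)
    have "x \<notin> open_cone a b \<union> open_cone b (b - a)" if "x \<in> open_cone (b - a) (- a)" for x
      using that det2_swap[of x] by (auto simp: open_cone_def)
    then show "(K \<inter> open_cone a b \<union> K \<inter> open_cone b (b - a)) \<inter> (K \<inter> open_cone (b - a) (- a)) = {}"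
      by blast
  qed (use a_pos in \<open>auto intro!: fm halfplane sets.Un sets.Int\<close>)
  ultimately show ?thesis using 1 2 3 by linarith
qed

section \<open>Inscribed affine regular hexagons and the area bound\<close>

lemma not_in_scaled_frontier:
  fixes K :: "'a::euclidean_space set"
  assumes "convex K" "0 \<in> interior K" "u \<in> frontier K" "r > 1"
  shows "r *\<^sub>R u \<notin> K"
proof
  assume "r *\<^sub>R u \<in> K"
  \<comment> \<open>Moving from \<open>r *\<^sub>R u\<close> towards the interior point 0 reaches
    \<open>u\<close>, which would then be interior.\<close>
  then have "r *\<^sub>R u - (1 - 1 / r) *\<^sub>R (r *\<^sub>R u - 0) \<in> interior K"
    using assms by (intro mem_interior_convex_shrink) auto
  also have "r *\<^sub>R u - (1 - 1 / r) *\<^sub>R (r *\<^sub>R u - 0) = u"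
    using assms by (simp add: algebra_simps)
  finally show False using assms by (simp add: frontier_def)
qed

text \<open>The vertices are the points \<open>a\<close>, \<open>b\<close>, \<open>b - a\<close> and
  their negatives. An arbitrary frontier point serves as \<open>a\<close>; \<open>b\<close> comes
  from connectedness of the frontier, because translation by \<open>- a\<close> moves some frontier
  points into the interior and others outside \<open>K\<close>.\<close>

lemma inscribed_hexagon:
  fixes K :: "(real^2) set"
  assumes "compact K" "convex K" and sym: "\<And>x. x \<in> K \<Longrightarrow> - x \<in> K" and "0 \<in> interior K"
  obtains a b where "a \<in> frontier K" "b \<in> frontier K" "b - a \<in> frontier K" "det2 a b > 0"
proof -
  have "closed K" "bounded K" using \<open>compact K\<close> by (auto simp: compact_imp_closed compact_imp_bounded)
  \<comment> \<open>The dimension matters: only in dimension 1 is the relative frontier of a bounded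
    convex set disconnected.\<close>
  have "aff_dim K = 2" using \<open>0 \<in> interior K\<close> aff_dim_nonempty_interior[of K] by auto
  then have rel: "rel_frontier K = frontier K" and "connected (rel_frontier K)"
    using \<open>0 \<in> interior K\<close> \<open>convex K\<close> \<open>bounded K\<close> rel_frontier_nonempty_interior[of K]
      connected_sphere_gen[of K] by auto
  then have conn: "connected (frontier K)" by simp
  have K_frontier: "frontier K \<subseteq> K" using \<open>closed K\<close> by (rule frontier_subset_closed)
  have neg_interior: "- x \<in> interior K" if "x \<in> interior K" for x
  proof -
    have "uminus ` K = K" using sym by force
    then show ?thesis using interior_negations[of K] that by (metis image_eqI)
  qed
  then have neg_frontier: "- x \<in> frontier K" if "x \<in> frontier K" for x
    using that sym K_frontier \<open>closed K\<close> unfolding frontier_def by fastforce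
  have "frontier K \<noteq> {}"
    using \<open>bounded K\<close> \<open>0 \<in> interior K\<close> frontier_not_empty interior_subset not_bounded_UNIV by blast
  then obtain a where a: "a \<in> frontier K" by blast
  then have "a \<noteq> 0" using \<open>0 \<in> interior K\<close> by (auto simp: frontier_def)
  have "\<exists>b\<in>frontier K. b - a \<in> frontier K"
  proof (rule ccontr)
    assume none: "\<not> ?thesis"
    \<comment> \<open>Without a suitable \<open>b\<close> these two open sets would separate the
      frontier: \<open>a\<close> is moved to 0, and \<open>- a\<close> to \<open>- 2 a\<close>
      outside \<open>K\<close>.\<close>
    let ?U = "(\<lambda>x. x - a) -` interior K" and ?W = "(\<lambda>x. x - a) -` (- K)"
    have "open ?U" "open ?W"
      using \<open>closed K\<close> by (auto intro!: open_vimage continuous_intros)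
    moreover have "?U \<inter> ?W \<inter> frontier K = {}" using interior_subset by auto
    moreover have "frontier K \<subseteq> ?U \<union> ?W"
      using none \<open>closed K\<close> by (auto simp: frontier_def)
    moreover have "a \<in> ?U \<inter> frontier K" using a \<open>0 \<in> interior K\<close> by simp
    moreover have "- a \<in> ?W \<inter> frontier K"
    proof -
      have "2 *\<^sub>R (- a) \<notin> K"
        using not_in_scaled_frontier[of K "- a" 2] assms neg_frontier[OF a] by simp
      moreover have "- a - a = 2 *\<^sub>R (- a)" by (simp add: scaleR_2)
      ultimately show ?thesis using neg_frontier[OF a] by simp
    qed
    ultimately show False using conn unfolding connected_def by blast
  qed
  then obtain b where b: "b \<in> frontier K" "b - a \<in> frontier K" by blast
  have "det2 a b \<noteq> 0"
  proof
    assume "det2 a b = 0"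
    \<comment> \<open>The coefficient of the projection of \<open>b\<close> onto \<open>a\<close>,
      so dependence gives \<open>b = m *\<^sub>R a\<close>. The line through \<open>a\<close> meets
      the frontier only at \<open>a\<close> and \<open>- a\<close>, so both \<open>m\<close> and
      \<open>m - 1\<close> would have absolute value 1.\<close>
    define m where "m = (a $ 1 * b $ 1 + a $ 2 * b $ 2) / (a $ 1 ^ 2 + a $ 2 ^ 2)"
    have "a $ 1 ^ 2 + a $ 2 ^ 2 \<noteq> 0" using \<open>a \<noteq> 0\<close> by (auto simp: vec_eq_iff forall_2 sum_power2_eq_zero_iff)
    then have "(a $ 1 ^ 2 + a $ 2 ^ 2) *\<^sub>R b = (a $ 1 ^ 2 + a $ 2 ^ 2) *\<^sub>R m *\<^sub>R a"
      using \<open>det2 a b = 0\<close> by (simp add: m_def vec_eq_iff forall_2 det2_def power2_eq_square) algebra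
    then have bm: "b = m *\<^sub>R a" using \<open>a $ 1 ^ 2 + a $ 2 ^ 2 \<noteq> 0\<close> by (metis scaleR_cancel_left)
    note nis = not_in_scaled_frontier[OF \<open>convex K\<close> \<open>0 \<in> interior K\<close>]
    have "m \<noteq> 0" using b(1) bm \<open>0 \<in> interior K\<close> by (auto simp: frontier_def)
    have on_ray: "\<bar>k\<bar> = 1" if "k *\<^sub>R a \<in> frontier K" for k
    proof -
      have k: "\<bar>k\<bar> *\<^sub>R a \<in> frontier K" using that neg_frontier by (auto simp: abs_if)
      then have "k \<noteq> 0" using \<open>0 \<in> interior K\<close> by (auto simp: frontier_def)
      have "\<not> \<bar>k\<bar> > 1" using nis[OF a, of "\<bar>k\<bar>"] k K_frontier by auto
      moreover have "\<not> \<bar>k\<bar> < 1"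
        using nis[OF k, of "1 / \<bar>k\<bar>"] a K_frontier \<open>k \<noteq> 0\<close> by auto
      ultimately show ?thesis by linarith
    qed
    have "\<bar>m\<bar> = 1" using b(1) bm on_ray by blast
    moreover have "\<bar>m - 1\<bar> = 1" using b(2) bm by (intro on_ray) (simp add: algebra_simps)
    ultimately show False by linarith
  qed
  then consider "det2 a b > 0" | "det2 b a > 0" using det2_swap[of a b] by linarith
  then show thesis
  proof cases
    \<comment> \<open>With the other orientation \<open>a\<close> and \<open>b\<close> change roles,
      and the third vertex changes sign.\<close>
    case 2
    moreover have "a - b \<in> frontier K" using neg_frontier[OF b(2)] by simp
    ultimately show thesis using that a b by blast
  qed (use that a b in blast)
qed

text \<open>Containing the polar is what supplies the points \<open>z\<close> of
  \<open>sector_area\<close>: if \<open>det2\<close> with a vertex \<open>u\<close> stayed below 1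
  on \<open>K\<close>, a proper enlargement of \<open>u\<close> would lie in the polar and so in
  \<open>K\<close>, although \<open>u\<close> is a frontier point.\<close>

lemma area_ge_3:
  fixes K :: "(real^2) set"
  assumes "compact K" "convex K" and sym: "\<And>x. x \<in> K \<Longrightarrow> - x \<in> K" and "0 \<in> interior K"
    and polar: "\<And>y. \<forall>x\<in>K. det2 x y \<le> 1 \<Longrightarrow> y \<in> K"
  shows "3 \<le> measure lborel K"
proof -
  obtain a b where ab: "a \<in> frontier K" "b \<in> frontier K" "b - a \<in> frontier K" "det2 a b > 0"
    using inscribed_hexagon assms(1-4) by blast
  have "0 \<in> K" using \<open>0 \<in> interior K\<close> interior_subset by auto
  have "frontier K \<subseteq> K" using \<open>compact K\<close> by (simp add: compact_imp_closed frontier_subset_closed)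
  then have K: "a \<in> K" "b \<in> K" "b - a \<in> K" "- a \<in> K" "- b \<in> K" "- b - - a \<in> K"
    using ab sym[of a] sym[of b] sym[of "b - a"] by auto
  have bd: "r *\<^sub>R u \<notin> K" if "u \<in> {a, b, b - a}" "r > 1" for u r
    using not_in_scaled_frontier[of K u r] assms ab that by auto
  have wide: "\<exists>z\<in>K. det2 z u \<ge> 1" if u: "u \<in> {a, b, b - a}" for u
  proof -
    obtain z where z: "z \<in> K" "\<And>x. x \<in> K \<Longrightarrow> det2 x u \<le> det2 z u"
      using continuous_attains_sup[OF \<open>compact K\<close> _ continuous_on_det2(2)] \<open>0 \<in> K\<close> by blast
    have "det2 z u \<ge> 1"
    proof (rule ccontr)
      assume less: "\<not> ?thesis"
      \<comment> \<open>The midpoint of 1 and the maximum cut off at 0: positive, below 1 and still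
        an upper bound.\<close>
      define m where "m = (max 0 (det2 z u) + 1) / 2"
      have m: "0 < m" "m < 1" "det2 z u \<le> m" using less by (auto simp: m_def)
      have "det2 x ((1 / m) *\<^sub>R u) \<le> 1" if "x \<in> K" for x
        using z(2)[OF that] m by (simp add: field_simps)
      then show False using polar bd[OF u, of "1 / m"] m by auto
    qed
    then show ?thesis using z by blast
  qed
  have 1: "3 / 2 \<le> measure lborel (K \<inter> {x. det2 a x > 0})"
    by (rule half_hexagon_area[OF assms(1-3) \<open>0 \<in> K\<close> K(1-3) ab(4) bd wide])
  have neg: "- u \<in> {a, b, b - a}" if "u \<in> {- a, - b, - b - - a}" for u
    using that by auto
  \<comment> \<open>The opposite half plane is treated with the negated hexagon.\<close>
  have 2: "3 / 2 \<le> measure lborel (K \<inter> {x. det2 (- a) x > 0})"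
  proof (rule half_hexagon_area[OF assms(1-3) \<open>0 \<in> K\<close> K(4-6)])
    show "r *\<^sub>R u \<notin> K" if "u \<in> {- a, - b, - b - - a}" "r > 1" for u r
      using bd[OF neg[OF that(1)] that(2)] sym[of "r *\<^sub>R u"] by auto
    show "\<exists>z\<in>K. det2 z u \<ge> 1" if u: "u \<in> {- a, - b, - b - - a}" for u
      using wide[OF neg[OF u]] sym by force
    show "det2 (- a) (- b) > 0" using ab(4) by simp
  qed
  have "measure lborel (K \<inter> {x. det2 a x > 0}) + measure lborel (K \<inter> {x. det2 (- a) x > 0})
      \<le> measure lborel K"
  proof (rule measure_disjoint_sum_le)
    have "{x. det2 u x > 0} \<in> sets borel" for u
      by (intro borel_open open_Collect_less continuous_intros)
    then show "K \<inter> {x. det2 a x > 0} \<in> sets lborel" "K \<inter> {x. det2 (- a) x > 0} \<in> sets lborel"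
      using \<open>compact K\<close> by (auto simp: compact_imp_closed simp del: det2_linear intro!: sets.Int)
    show "K \<in> fmeasurable lborel" by (rule fmeasurable_compact[OF \<open>compact K\<close>])
  qed auto
  then show ?thesis using 1 2 by linarith
qed

subsection \<open>The norm of the iterated suspension\<close>

lemma scaleR_fun_apply [simp]: "(c *\<^sub>R f) x = c * f x" for f :: "'a \<Rightarrow> real"
  by (simp add: scaleR_fun_def)

lemma mem_R2n: "x \<in> R2n n \<longleftrightarrow> (\<forall>i\<ge>2 * n. x i = 0)"
  by (simp add: topspace_Euclidean_space)

definition tail :: "(nat \<Rightarrow> real) \<Rightarrow> nat \<Rightarrow> real" where
  "tail x = (\<lambda>i. x (i + 2))"

lemma tail_apply: "tail x i = x (i + 2)"
  by (simp add: tail_def)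

lemma tail_simps [simp]:
  "tail (x + y) = tail x + tail y" "tail (x - y) = tail x - tail y" "tail (c *\<^sub>R x) = c *\<^sub>R tail x" "tail (- x) = - tail x" "tail 0 = 0"
  "tail (join v w) = w" "tail (plane_vec a b) = 0"
  by (simp_all add: fun_eq_iff tail_def join_def plane_vec_def)

lemma plane_vec_simps [simp]:
  "plane_vec a b 0 = a" "plane_vec a b (Suc 0) = b"
  by (auto simp: plane_vec_def)

lemma join_simps [simp]: "join v w 0 = v 0" "join v w (Suc 0) = v (Suc 0)"
  by (auto simp: join_def)

lemma e_simps [simp]: "e 0 = 1" "e (Suc 0) = 1"
  by (auto simp: e_def)

lemma join_eqI: "x 0 = v 0 \<Longrightarrow> x 1 = v 1 \<Longrightarrow> tail x = w \<Longrightarrow> x = join v w"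
proof
  fix i :: nat assume *: "x 0 = v 0" "x 1 = v 1" "tail x = w"
  have "i = 0 \<or> i = 1 \<or> (\<exists>j. i = j + 2)" by presburger
  then consider "i = 0" | "i = 1" | j where "i = j + 2" by blast
  then show "x i = join v w i"
  proof cases
    case 3
    have "x i = tail x j" by (simp add: 3 tail_def)
    also have "\<dots> = w j" by (simp only: *)
    also have "\<dots> = join v w i" by (simp add: 3 join_def)
    finally show ?thesis .
  qed (use * in simp_all)
qed

lemma vec_eqI: "x 0 = y 0 \<Longrightarrow> x 1 = y 1 \<Longrightarrow> tail x = tail y \<Longrightarrow> x = y"
  using join_eqI[of x y "tail y"] join_eqI[of y y "tail y"] by simp

lemma join_tail: "join (plane_vec (x 0) (x 1)) (tail x) = x"
  by (rule join_eqI[symmetric]) auto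

lemma tail_mem_R2n: "tail x \<in> R2n n \<longleftrightarrow> x \<in> R2n (Suc n)"
  unfolding mem_R2n tail_def
  by (auto simp: nat_le_iff_add)

lemma join_mem_R2n [simp]: "join v w \<in> R2n (Suc n) \<longleftrightarrow> w \<in> R2n n"
  by (simp only: tail_mem_R2n[symmetric] tail_simps)

lemma plane_vec_mem_R2n [simp]: "n \<ge> 1 \<Longrightarrow> plane_vec a b \<in> R2n n"
  by (auto simp: mem_R2n plane_vec_def)

lemma zero_mem_Euclidean_space [simp]: "0 \<in> topspace (Euclidean_space m)"
  by (simp add: topspace_Euclidean_space)

lemma uminus_mem_R2n [simp]: "- x \<in> R2n n \<longleftrightarrow> x \<in> R2n n"
  and add_mem_R2n: "x \<in> R2n n \<Longrightarrow> y \<in> R2n n \<Longrightarrow> x + y \<in> R2n n"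
  and scaleR_mem_R2n: "x \<in> R2n n \<Longrightarrow> c *\<^sub>R x \<in> R2n n"
  by (auto simp: mem_R2n)

lemma R2n_0: "R2n 0 = {0}"
  by (auto simp: topspace_Euclidean_space fun_eq_iff)

lemma omega_0 [simp]: "omega 0 x y = 0"
  by (simp add: omega_def)

lemma omega_Suc:
  "omega (Suc n) x y = x 0 * y 1 - x 1 * y 0 + omega n (tail x) (tail y)"
  by (simp add: omega_def tail_def sum.lessThan_Suc_shift del: sum.lessThan_Suc)

lemma omega_linear [simp]:
  "omega n (x + x') y = omega n x y + omega n x' y" "omega n x (y + y') = omega n x y + omega n x y'"
  "omega n (c *\<^sub>R x) y = c * omega n x y" "omega n x (c *\<^sub>R y) = c * omega n x y"
  "omega n 0 y = 0" "omega n x 0 = 0"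
  "omega n (- x) y = - omega n x y"
  by (simp_all add: omega_def algebra_simps sum.distrib sum_subtractf sum_distrib_left sum_negf)

text \<open>The hexagon \<open>P\<close> is given by |x0|, |x1|, |x0 - x1| \<le> 1, and |x0 - x1| is
  |omega(e, v1)|. In the suspension the third bound is absorbed by the condition that also involves
  the tail.\<close>

primrec P_norm :: "nat \<Rightarrow> (nat \<Rightarrow> real) \<Rightarrow> real" where
  "P_norm 0 x = 0"
| "P_norm (Suc n) x = max (max \<bar>x 0\<bar> \<bar>x 1\<bar>) (\<bar>x 0 - x 1\<bar> + P_norm n (tail x))"

definition P_ball :: "nat \<Rightarrow> (nat \<Rightarrow> real) set" where
  "P_ball n = {x \<in> R2n n. P_norm n x \<le> 1}"

lemma P_ball_Suc:
  "x \<in> P_ball (Suc n) \<longleftrightarrow>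
     \<bar>x 0\<bar> \<le> 1 \<and> \<bar>x 1\<bar> \<le> 1 \<and> \<bar>x 0 - x 1\<bar> + P_norm n (tail x) \<le> 1 \<and> tail x \<in> R2n n"
  by (auto simp: P_ball_def tail_mem_R2n)

lemma P_norm_nonneg [simp]: "P_norm n x \<ge> 0"
  by (cases n) (auto simp: le_max_iff_disj)

(* Here and below, induction hypotheses and goals are restated: the induction method eta-expands
   function-valued terms such as 0 and x + y, and the simplifier no longer recognizes them. *)
lemma P_norm_zero [simp]: "P_norm n 0 = 0"
proof (induction n)
  case (Suc n)
  have "P_norm n 0 = 0" by (rule Suc)
  then show "P_norm (Suc n) 0 = 0" by simp
qed simp

lemma P_norm_uminus [simp]: "P_norm n (- x) = P_norm n x"
proof (induction n arbitrary: x)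
  case (Suc n)
  have "P_norm n (- tail x) = P_norm n (tail x)" by (rule Suc)
  then show "P_norm (Suc n) (- x) = P_norm (Suc n) x"
    by (simp add: abs_minus_commute[of "x 0" "x 1", simplified])
qed simp

lemma P_norm_triangle: "P_norm n (x + y) \<le> P_norm n x + P_norm n y"
proof (induction n arbitrary: x y)
  case (Suc n)
  have "P_norm n (tail x + tail y) \<le> P_norm n (tail x) + P_norm n (tail y)" by (rule Suc)
  moreover have bounds: "\<bar>z 0\<bar> \<le> P_norm (Suc n) z" "\<bar>z 1\<bar> \<le> P_norm (Suc n) z"
      "\<bar>z 0 - z 1\<bar> + P_norm n (tail z) \<le> P_norm (Suc n) z" for z
    by (simp_all add: le_max_iff_disj)
  ultimately have "\<bar>x 0 - x 1 + (y 0 - y 1)\<bar> + P_norm n (tail x + tail y) \<le> P_norm (Suc n) x + P_norm (Suc n) y"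
    using bounds(3)[of x] bounds(3)[of y] abs_triangle_ineq[of "x 0 - x 1" "y 0 - y 1"] by linarith
  moreover have "\<bar>x 0 + y 0\<bar> \<le> P_norm (Suc n) x + P_norm (Suc n) y"
    using bounds(1)[of x] bounds(1)[of y] abs_triangle_ineq[of "x 0" "y 0"] by linarith
  moreover have "\<bar>x 1 + y 1\<bar> \<le> P_norm (Suc n) x + P_norm (Suc n) y"
    using bounds(2)[of x] bounds(2)[of y] abs_triangle_ineq[of "x 1" "y 1"] by linarith
  ultimately have "max (max \<bar>(x + y) 0\<bar> \<bar>(x + y) 1\<bar>) (\<bar>(x + y) 0 - (x + y) 1\<bar> + P_norm n (tail (x + y)))
      \<le> P_norm (Suc n) x + P_norm (Suc n) y"
    by (simp add: diff_add_eq diff_diff_eq2 add_diff_add del: P_norm.simps)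
  then show "P_norm (Suc n) (x + y) \<le> P_norm (Suc n) x + P_norm (Suc n) y"
    by (simp only: P_norm.simps)
qed simp

lemma P_norm_scaleR: "P_norm n (c *\<^sub>R x) = \<bar>c\<bar> * P_norm n x"
proof (induction n arbitrary: x)
  case (Suc n)
  have "\<bar>c * x 0 - c * x 1\<bar> = \<bar>c\<bar> * \<bar>x 0 - x 1\<bar>"
    by (simp flip: abs_mult right_diff_distrib)
  moreover have "P_norm n (c *\<^sub>R tail x) = \<bar>c\<bar> * P_norm n (tail x)" by (rule Suc)
  ultimately have "P_norm (Suc n) (c *\<^sub>R x)
      = max (max (\<bar>c\<bar> * \<bar>x 0\<bar>) (\<bar>c\<bar> * \<bar>x 1\<bar>)) (\<bar>c\<bar> * \<bar>x 0 - x 1\<bar> + \<bar>c\<bar> * P_norm n (tail x))"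
    by (simp only: P_norm.simps tail_simps scaleR_fun_apply abs_mult)
  also have "\<dots> = \<bar>c\<bar> * P_norm (Suc n) x"
    by (simp only: P_norm.simps max_mult_distrib_left distrib_left abs_ge_zero if_True)
  finally show "P_norm (Suc n) (c *\<^sub>R x) = \<bar>c\<bar> * P_norm (Suc n) x" .
qed simp

lemma P_norm_eq_0: "x \<in> R2n n \<Longrightarrow> P_norm n x = 0 \<Longrightarrow> x = 0"
proof (induction n arbitrary: x)
  case (Suc n)
  have "x 0 = 0" "x 1 = 0" "P_norm n (tail x) \<le> 0" using Suc.prems(2) by auto
  moreover have "tail x = 0"
  proof (rule Suc.IH)
    show "tail x \<in> R2n n" "P_norm n (tail x) = 0"
      using Suc.prems(1) calculation by (simp_all add: tail_mem_R2n order_antisym)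
  qed
  ultimately show "x = 0" by - (rule vec_eqI, auto)
next
  case 0
  then show "x = 0" unfolding R2n_0 by blast
qed

lemma continuous_on_P_norm: "continuous_on S (P_norm n)"
proof -
  have coord: "continuous_on UNIV (\<lambda>x::nat \<Rightarrow> real. x i)" for i
    by (rule continuous_on_product_coordinates)
  have "continuous_on UNIV (P_norm n)"
  proof (induction n)
    case (Suc n)
    have "continuous_on UNIV tail"
      unfolding tail_def by (intro continuous_on_coordinatewise_then_product coord)
    then have "continuous_on UNIV (\<lambda>x. P_norm n (tail x))"
      by (rule continuous_on_compose2[OF Suc]) simp
    then have "continuous_on UNIV (\<lambda>x. max (max \<bar>x 0\<bar> \<bar>x 1\<bar>) (\<bar>x 0 - x 1\<bar> + P_norm n (tail x)))"
      by (intro continuous_on_max continuous_on_rabs continuous_on_add continuous_on_diff coord)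
    then show "continuous_on UNIV (P_norm (Suc n))"
      by (rule continuous_on_eq) simp
  next
    case 0
    have "continuous_on UNIV (\<lambda>x::nat \<Rightarrow> real. 0 :: real)" by simp
    then show "continuous_on UNIV (P_norm 0)" by (rule continuous_on_eq) simp
  qed
  then show ?thesis by (rule continuous_on_subset) simp
qed

lemma convex_P_ball: "convex (P_ball n)"
proof (rule convexI)
  fix x y and u v :: real
  assume *: "x \<in> P_ball n" "y \<in> P_ball n" "0 \<le> u" "0 \<le> v" "u + v = 1"
  then have "P_norm n (u *\<^sub>R x + v *\<^sub>R y) \<le> u * P_norm n x + v * P_norm n y"
    using P_norm_triangle[of n "u *\<^sub>R x" "v *\<^sub>R y"] by (simp add: P_norm_scaleR)
  also have "\<dots> \<le> 1" using * by (intro convex_bound_le) (auto simp: P_ball_def)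
  finally show "u *\<^sub>R x + v *\<^sub>R y \<in> P_ball n"
    using * by (simp add: P_ball_def add_mem_R2n scaleR_mem_R2n)
qed

lemma zero_mem_P_ball [simp]: "0 \<in> P_ball n"
  by (simp add: P_ball_def)

lemma uminus_mem_P_ball [simp]: "- x \<in> P_ball n \<longleftrightarrow> x \<in> P_ball n"
  by (simp add: P_ball_def)

lemma P_ball_0: "P_ball 0 = {0}"
  unfolding P_ball_def R2n_0 by auto

lemma P_ball_absorbing: "v \<in> R2n n \<Longrightarrow> \<exists>t>0. t *\<^sub>R v \<in> P_ball n"
proof (intro exI conjI)
  assume "v \<in> R2n n"
  \<comment> \<open>Adding 1 keeps the scaling factor well defined for \<open>v = 0\<close>.\<close>
  have "0 < P_norm n v + 1" using P_norm_nonneg[of n v] by linarith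
  then show "1 / (P_norm n v + 1) > 0" "(1 / (P_norm n v + 1)) *\<^sub>R v \<in> P_ball n"
    using \<open>v \<in> R2n n\<close> by (simp_all add: P_ball_def P_norm_scaleR scaleR_mem_R2n)
qed

lemma body_norm_P_ball:
  assumes "v \<in> R2n n" shows "body_norm (P_ball n) v = P_norm n v"
proof -
  have "v \<in> (\<lambda>x. t *\<^sub>R x) ` P_ball n \<longleftrightarrow> P_norm n v \<le> t" if "t > 0" for t
  proof
    assume "v \<in> (\<lambda>x. t *\<^sub>R x) ` P_ball n"
    then show "P_norm n v \<le> t" using that by (auto simp: P_ball_def P_norm_scaleR)
  next
    assume "P_norm n v \<le> t"
    then have "(1 / t) *\<^sub>R v \<in> P_ball n"
      using that assms by (simp add: P_ball_def P_norm_scaleR scaleR_mem_R2n)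
    then show "v \<in> (\<lambda>x. t *\<^sub>R x) ` P_ball n"
      using that by (intro image_eqI[of _ _ "(1 / t) *\<^sub>R v"]) auto
  qed
  then have "body_norm (P_ball n) v = Inf {t. 0 < t \<and> P_norm n v \<le> t}"
    unfolding body_norm_def by (intro arg_cong[of _ _ Inf]) auto
  also have "\<dots> = P_norm n v"
  \<comment> \<open>Only positive \<open>t\<close> enter the infimum, so for norm 0 it is not
    attained.\<close>
  proof (cases "P_norm n v = 0")
    case True
    then have "{t. 0 < t \<and> P_norm n v \<le> t} = {0<..}" by auto
    then show ?thesis using True by simp
  next
    case False
    then have "0 < P_norm n v" using P_norm_nonneg[of n v] by linarith
    then have "{t. 0 < t \<and> P_norm n v \<le> t} = {P_norm n v..}" by auto
    then show ?thesis by simp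
  qed
  finally show ?thesis .
qed

section \<open>The unit ball as a polytope\<close>

text \<open>Starting from the single point 0 makes the step to dimension 2 produce the hexagon: its
  vertices \<open>e\<close> and \<open>- e\<close> are the two lifts of 0.\<close>

primrec P_vertices :: "nat \<Rightarrow> (nat \<Rightarrow> real) set" where
  "P_vertices 0 = {0}"
| "P_vertices (Suc n) =
     {plane_vec 1 0, - plane_vec 1 0, plane_vec 0 1, - plane_vec 0 1}
     \<union> (join e ` P_vertices n \<union> join (- e) ` P_vertices n)"

lemma finite_P_vertices [simp]: "finite (P_vertices n)"
  by (induction n) auto

lemma uminus_join: "- join v w = join (- v) (- w)"
  by (rule join_eqI) auto

lemma P_vertices_uminus: "v \<in> P_vertices n \<Longrightarrow> - v \<in> P_vertices n"
proof (induction n arbitrary: v)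
  case 0
  then have "v = 0" by simp
  then show "- v \<in> P_vertices 0" by simp
next
  case (Suc n)
  have IH: "- w \<in> P_vertices n" if "w \<in> P_vertices n" for w by (rule Suc.IH[OF that])
  have "- v \<in> P_vertices (Suc n)" if "v = join a w" "a \<in> {e, - e}" "w \<in> P_vertices n" for a w
    using that IH by (auto simp: uminus_join)
  with Suc.prems show "- v \<in> P_vertices (Suc n)" by auto
qed

lemma P_vertices_subset: "P_vertices n \<subseteq> P_ball n"
proof (induction n)
  case 0
  show "P_vertices 0 \<subseteq> P_ball 0" by simp
next
  case (Suc n)
  have "join a w \<in> P_ball (Suc n)" if "a \<in> {e, - e}" "w \<in> P_vertices n" for a w
  proof -
    have "w \<in> P_ball n" using Suc that by blast
    then show ?thesis using that(1) by (auto simp: P_ball_Suc) (auto simp: P_ball_def)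
  qed
  moreover have "plane_vec 1 0 \<in> P_ball (Suc n)" "plane_vec 0 1 \<in> P_ball (Suc n)"
    by (simp_all add: P_ball_Suc)
  ultimately show "P_vertices (Suc n) \<subseteq> P_ball (Suc n)"
    unfolding P_vertices.simps by (simp add: image_subset_iff)
qed

text \<open>On the line \<open>x 1 - x 0 = s\<close> the hexagon cuts out a segment of length
  \<open>2 - s\<close> in the coordinate \<open>x 0\<close>, and \<open>u\<close> is the relative
  position of \<open>x\<close> on it. The point \<open>x\<close> then mixes, with weights
  \<open>1 - s\<close> and \<open>s\<close>, the points at parameter \<open>u\<close> on the segment
  from \<open>join (- e) w\<close> to \<open>join e w\<close> and on the edge from (-1, 0) to (0,
  1).\<close>

lemma mem_hull_P_vertices_if_le:
  assumes IH: "P_ball n = convex hull P_vertices n"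
    and x: "x \<in> P_ball (Suc n)" and pos: "x 0 \<le> x 1"
  shows "x \<in> convex hull P_vertices (Suc n)" (is "x \<in> ?H")
proof -
  note H = convexD[OF convex_convex_hull]
  define s where "s = x 1 - x 0"
  define u where "u = (x 0 + 1) / (2 - s)"
  define w where "w = (1 / (1 - s)) *\<^sub>R tail x"
  have bds: "\<bar>x 0\<bar> \<le> 1" "\<bar>x 1\<bar> \<le> 1" "s + P_norm n (tail x) \<le> 1" "s \<ge> 0" "tail x \<in> R2n n"
    using x pos by (auto simp: P_ball_def s_def tail_mem_R2n)
  have s1: "s \<le> 1" using bds P_norm_nonneg[of n "tail x"] by linarith
  have u: "0 \<le> u" "u \<le> 1" "u * (2 - s) = x 0 + 1"
    using bds s1 by (auto simp: u_def s_def field_simps)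
  have w: "w \<in> P_ball n" "(1 - s) *\<^sub>R w = tail x"
  proof -
    show "w \<in> P_ball n" using bds s1
      by (cases "s = 1") (auto simp: w_def P_ball_def P_norm_scaleR scaleR_mem_R2n)
    \<comment> \<open>For \<open>s = 1\<close> the division makes \<open>w = 0\<close>, which is
      consistent since no norm is left for the tail.\<close>
    have "tail x = 0" if "s = 1" using that bds P_norm_eq_0[of "tail x" n] P_norm_nonneg[of n "tail x"] by simp
    then show "(1 - s) *\<^sub>R w = tail x" by (cases "s = 1") (auto simp: w_def)
  qed
  have "join a w \<in> ?H" if "a \<in> {e, - e}" for a
  proof -
    have "convex {w. join a w \<in> ?H}"
    proof (rule convexI)
      fix y z and k l :: real
      assume *: "y \<in> {w. join a w \<in> ?H}" "z \<in> {w. join a w \<in> ?H}" "0 \<le> k" "0 \<le> l" "k + l = 1"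
      have "join a (k *\<^sub>R y + l *\<^sub>R z) = k *\<^sub>R join a y + l *\<^sub>R join a z"
        using * by (intro join_eqI[symmetric]) (auto simp flip: distrib_right)
      also have "\<dots> \<in> ?H" using * by (intro H) auto
      finally show "k *\<^sub>R y + l *\<^sub>R z \<in> {w. join a w \<in> ?H}" by simp
    qed
    moreover have "P_vertices n \<subseteq> {w. join a w \<in> ?H}"
      using that by (auto intro!: hull_inc)
    ultimately show ?thesis using w(1) unfolding IH using hull_minimal by blast
  qed
  then have 1: "u *\<^sub>R join e w + (1 - u) *\<^sub>R join (- e) w \<in> ?H"
    using u by (intro H) auto
  have 2: "(1 - u) *\<^sub>R (- plane_vec 1 0) + u *\<^sub>R plane_vec 0 1 \<in> ?H"
    using u by (intro H) (auto intro: hull_inc)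
  have "(1 - s) *\<^sub>R (u *\<^sub>R join e w + (1 - u) *\<^sub>R join (- e) w)
      + s *\<^sub>R ((1 - u) *\<^sub>R (- plane_vec 1 0) + u *\<^sub>R plane_vec 0 1) \<in> ?H" (is "?y \<in> _")
    by (rule H[OF 1 2]) (use bds s1 in linarith)+
  also have "?y = x"
  proof (rule vec_eqI)
    show "tail ?y = tail x" by (simp add: w(2) flip: scaleR_left_distrib)
    show "?y 0 = x 0" "?y 1 = x 1" using u(3) by (simp_all add: algebra_simps s_def)
  qed
  finally show ?thesis .
qed

lemma P_ball_eq_hull: "P_ball n = convex hull P_vertices n"
proof (induction n)
  case 0
  show "P_ball 0 = convex hull P_vertices 0" by (simp add: P_ball_0)
next
  case (Suc n)
  show "P_ball (Suc n) = convex hull P_vertices (Suc n)"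
  proof
    show "convex hull P_vertices (Suc n) \<subseteq> P_ball (Suc n)"
      by (rule hull_minimal[where S = convex, OF P_vertices_subset convex_P_ball])
    show "P_ball (Suc n) \<subseteq> convex hull P_vertices (Suc n)"
    proof
      fix x assume x: "x \<in> P_ball (Suc n)"
      show "x \<in> convex hull P_vertices (Suc n)"
      proof (cases "x 0 \<le> x 1")
        \<comment> \<open>The other side of the diagonal is reached by negation, under which the
          vertex set is invariant.\<close>
        case False
        then have "- x \<in> convex hull P_vertices (Suc n)"
          using x by (intro mem_hull_P_vertices_if_le[OF Suc]) auto
        then have "x \<in> uminus ` (convex hull P_vertices (Suc n))" by force
        also have "\<dots> = convex hull (uminus ` P_vertices (Suc n))"
          by (intro convex_hull_linear_image)
            (auto simp: linear_iff)
        also have "\<dots> \<subseteq> convex hull P_vertices (Suc n)"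
          by (intro hull_mono image_subsetI) (rule P_vertices_uminus)
        finally show ?thesis .
      qed (rule mem_hull_P_vertices_if_le[OF Suc x])
    qed
  qed
qed

section \<open>The iterated suspension is the unit ball\<close>

lemma P_eq_P_ball: "P = P_ball 1"
proof -
  have "join e 0 = plane_vec 1 1" "join (- e) 0 = - plane_vec 1 1"
    by (rule join_eqI[symmetric]; simp)+
  then have "P_vertices 1 = {plane_vec 1 1, - plane_vec 1 1, plane_vec 1 0, - plane_vec 1 0,
                    plane_vec 0 1, - plane_vec 0 1}"
    by auto
  then show ?thesis unfolding P_def P_ball_eq_hull by simp
qed

lemma P_suspension_P_ball: "P_suspension n (P_ball n) = P_ball (Suc n)"
proof (intro set_eqI iffI)
  fix x assume "x \<in> P_suspension n (P_ball n)"
  then show "x \<in> P_ball (Suc n)"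
    by (auto simp: P_suspension_def P_eq_P_ball P_ball_Suc body_norm_P_ball omega_Suc abs_minus_commute)
next
  fix x assume x: "x \<in> P_ball (Suc n)"
  \<comment> \<open>Membership of the first part in \<open>P\<close> needs this bound too; it
    follows because the tail has nonnegative norm.\<close>
  have "\<bar>x 0 - x 1\<bar> \<le> 1"
    using x P_norm_nonneg[of n "tail x"] unfolding P_ball_Suc by linarith
  with x have "plane_vec (x 0) (x 1) \<in> P \<and> tail x \<in> R2n n \<and>
     \<bar>omega 1 e (plane_vec (x 0) (x 1))\<bar> + body_norm (P_ball n) (tail x) \<le> 1"
    by (auto simp: P_eq_P_ball P_ball_Suc body_norm_P_ball omega_Suc abs_minus_commute)
  then have "join (plane_vec (x 0) (x 1)) (tail x) \<in> P_suspension n (P_ball n)"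
    unfolding P_suspension_def by blast
  then show "x \<in> P_suspension n (P_ball n)" by (simp only: join_tail)
qed

lemma P_power_eq_P_ball: "P_power n = P_ball n"
proof (induction n rule: P_power.induct)
  case (3 n)
  then show ?case by (simp only: P_power.simps P_suspension_P_ball)
qed (simp_all add: P_ball_0 P_eq_P_ball)

section \<open>Extreme points and their number\<close>

lemma extreme_point_ofI:
  assumes "x \<in> S" and "\<And>a b t. a \<in> S \<Longrightarrow> b \<in> S \<Longrightarrow> 0 < t \<Longrightarrow> t < 1 \<Longrightarrow> x = (1 - t) *\<^sub>R a + t *\<^sub>R b \<Longrightarrow> a = b"
  shows "x extreme_point_of S"
  using assms unfolding extreme_point_of_def in_segment by metis

lemma extreme_point_ofD:
  assumes "x extreme_point_of S" "a \<in> S" "b \<in> S" "0 < t" "t < 1" "x = (1 - t) *\<^sub>R a + t *\<^sub>R b"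
  shows "a = b"
  using assms unfolding extreme_point_of_def in_segment by metis

lemma extreme_point_of_uminus:
  assumes "v extreme_point_of S" "\<And>x. x \<in> S \<Longrightarrow> - x \<in> S"
  shows "(- v) extreme_point_of S"
proof (rule extreme_point_ofI)
  show "- v \<in> S" using assms by (simp add: extreme_point_of_def)
  fix a b and t :: real
  assume *: "a \<in> S" "b \<in> S" "0 < t" "t < 1" "- v = (1 - t) *\<^sub>R a + t *\<^sub>R b"
  then have "v = (1 - t) *\<^sub>R - a + t *\<^sub>R - b"
    by (metis minus_add_distrib minus_minus scaleR_minus_right)
  then have "- a = - b" using extreme_point_ofD[OF assms(1), of "- a" "- b" t] * assms(2) by blast
  then show "a = b" by simp
qed

lemma convex_combination_eq_1:
  fixes a b t :: real
  assumes "a \<le> 1" "b \<le> 1" "0 < t" "t < 1" "1 = (1 - t) * a + t * b"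
  shows "a = 1" "b = 1"
proof -
  have "(1 - t) * (1 - a) + t * (1 - b) = 0" using assms(5) by (simp add: algebra_simps)
  moreover have "(1 - t) * (1 - a) \<ge> 0" "t * (1 - b) \<ge> 0" using assms by auto
  ultimately have "(1 - t) * (1 - a) = 0" "t * (1 - b) = 0" by linarith+
  then show "a = 1" "b = 1" using assms by auto
qed

text \<open>At a lift over \<open>e\<close> both leading coordinates are maximal, so the endpoints
  of a segment through it share them and the tails are settled by induction. At (1, 0) or (0, 1) the
  maximal coordinate is fixed, the bound on the difference makes the other one nonnegative and hence
  0, and no norm remains for the tail. Symmetry gives the negatives.\<close>

lemma P_vertices_extreme: "v \<in> P_vertices n \<Longrightarrow> v extreme_point_of P_ball n"
proof (induction n arbitrary: v)
  case 0
  then have "v = 0" by simp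
  then show "v extreme_point_of P_ball 0" unfolding P_ball_0 by (simp add: extreme_point_of_def)
next
  case (Suc n)
  note sym = extreme_point_of_uminus[of _ "P_ball (Suc n)"]
  have 1: "join e w extreme_point_of P_ball (Suc n)" if w: "w \<in> P_vertices n" for w
  proof (rule extreme_point_ofI)
    show "join e w \<in> P_ball (Suc n)" using P_vertices_subset[of "Suc n"] w by auto
    fix a b and t :: real
    assume *: "a \<in> P_ball (Suc n)" "b \<in> P_ball (Suc n)" "0 < t" "t < 1" "join e w = (1 - t) *\<^sub>R a + t *\<^sub>R b"
    have "join e w i = ((1 - t) *\<^sub>R a + t *\<^sub>R b) i" for i using *(5) by simp
    from this[of 0] this[of 1] have "1 = (1 - t) * a 0 + t * b 0" "1 = (1 - t) * a 1 + t * b 1"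
      by simp_all
    then have eq: "a 0 = 1" "b 0 = 1" "a 1 = 1" "b 1 = 1"
      using convex_combination_eq_1[of "a 0" "b 0" t] convex_combination_eq_1[of "a 1" "b 1" t] *
      by (auto simp: P_ball_def)
    then have "tail a \<in> P_ball n" "tail b \<in> P_ball n" using * by (auto simp: P_ball_def tail_mem_R2n)
    moreover have "w = (1 - t) *\<^sub>R tail a + t *\<^sub>R tail b" using arg_cong[OF *(5), of tail] by simp
    ultimately have "tail a = tail b" using extreme_point_ofD[OF Suc.IH[OF w]] * by blast
    then show "a = b" using eq by - (rule vec_eqI, auto)
  qed
  have 2: "plane_vec c (1 - c) extreme_point_of P_ball (Suc n)" if c: "c \<in> {0, 1}" for c
  proof (rule extreme_point_ofI)
    show "plane_vec c (1 - c) \<in> P_ball (Suc n)" using P_vertices_subset[of "Suc n"] c by auto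
    fix a b and t :: real
    assume *: "a \<in> P_ball (Suc n)" "b \<in> P_ball (Suc n)" "0 < t" "t < 1" "plane_vec c (1 - c) = (1 - t) *\<^sub>R a + t *\<^sub>R b"
    have coord: "plane_vec c (1 - c) i = ((1 - t) *\<^sub>R a + t *\<^sub>R b) i" for i using *(5) by simp
    \<comment> \<open>The position of the entry 1, so that both points are handled at once.\<close>
    define k where "k = (if c = 1 then 0 else 1 :: nat)"
    have k: "1 = (1 - t) * a k + t * b k" using coord[of k] c by (auto simp: k_def)
    have l: "0 = (1 - t) * a (1 - k) + t * b (1 - k)" using coord[of "1 - k"] c by (auto simp: k_def)
    have ineq: "\<bar>x k\<bar> \<le> 1" "\<bar>x k - x (1 - k)\<bar> + P_norm n (tail x) \<le> 1" if "x \<in> P_ball (Suc n)" for x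
      using that by (auto simp: P_ball_def k_def abs_minus_commute)
    have eq: "a k = 1" "b k = 1"
      using convex_combination_eq_1[OF _ _ _ _ k] ineq(1) * by fastforce+
    have "a (1 - k) \<ge> 0" "b (1 - k) \<ge> 0"
      using ineq(2)[of a] ineq(2)[of b] P_norm_nonneg[of n "tail a"] P_norm_nonneg[of n "tail b"] * eq by linarith+
    then have "(1 - t) * a (1 - k) \<ge> 0" "t * b (1 - k) \<ge> 0" using * by auto
    then have "(1 - t) * a (1 - k) = 0" "t * b (1 - k) = 0" using l by linarith+
    then have eq': "a (1 - k) = 0" "b (1 - k) = 0" using * by auto
    have "P_norm n (tail a) = 0" "P_norm n (tail b) = 0"
      using ineq(2)[of a] ineq(2)[of b] P_norm_nonneg[of n "tail a"] P_norm_nonneg[of n "tail b"] * eq eq' by linarith+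
    then have "tail a = 0" "tail b = 0" using * by (auto intro!: P_norm_eq_0 simp: P_ball_def tail_mem_R2n)
    then show "a = b" using eq eq' by - (rule vec_eqI, auto simp: k_def split: if_splits)
  qed
  from Suc.prems consider
    "v = plane_vec 1 0 \<or> v = plane_vec 0 1" | "v = - plane_vec 1 0 \<or> v = - plane_vec 0 1"
    | w where "w \<in> P_vertices n" "v = join e w" | w where "w \<in> P_vertices n" "v = join (- e) w"
    by auto
  then show ?case
  proof cases
    case 1
    then show ?thesis using 2[of 0] 2[of 1] by auto
  next
    case 2
    then show ?thesis using \<open>\<And>c. c \<in> {0, 1} \<Longrightarrow> _\<close>[of 0] \<open>\<And>c. c \<in> {0, 1} \<Longrightarrow> _\<close>[of 1] sym by auto
  next
    case 3
    then show ?thesis using 1 by auto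
  next
    case 4
    then have "v = - join e (- w)" by (simp add: uminus_join)
    moreover have "- join e (- w) extreme_point_of P_ball (Suc n)"
      by (rule sym[OF 1[OF P_vertices_uminus[OF 4(1)]]]) simp
    ultimately show ?thesis by (simp only:)
  qed
qed

lemma vertices_P_ball: "vertices (P_ball n) = P_vertices n"
  unfolding vertices_def
  using P_vertices_extreme extreme_point_of_convex_hull[of _ "P_vertices n"] P_ball_eq_hull by auto

text \<open>The recursion is c -> 2 c + 4, under which \<open>c + 4\<close> doubles; it starts at 5.
  The additive form avoids truncated subtraction.\<close>

lemma card_P_vertices: "card (P_vertices n) + 4 = 5 * 2 ^ n"
proof (induction n)
  case (Suc n)
  let ?A = "{plane_vec 1 0, - plane_vec 1 0, plane_vec 0 1, - plane_vec 0 1}"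
  have inj: "inj_on (join a) S" for a S by (metis inj_onI tail_simps(6))
  have distinct: "x \<noteq> y" if "x 0 \<noteq> y 0 \<or> x 1 \<noteq> y 1" for x y :: "nat \<Rightarrow> real" using that by auto
  have "plane_vec 1 0 \<noteq> - plane_vec 1 0" "plane_vec 1 0 \<noteq> plane_vec 0 1"
    "plane_vec 1 0 \<noteq> - plane_vec 0 1" "- plane_vec 1 0 \<noteq> plane_vec 0 1"
    "- plane_vec 1 0 \<noteq> - plane_vec 0 1" "plane_vec 0 1 \<noteq> - plane_vec 0 1"
    by (rule distinct; simp)+
  then have A4: "card ?A = 4" by simp
  have ee: "join e ` P_vertices n \<inter> join (- e) ` P_vertices n = {}"
    by (auto dest!: fun_cong[of _ _ 0])
  have A: "?A \<inter> (join e ` P_vertices n \<union> join (- e) ` P_vertices n) = {}"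
    by (auto dest: fun_cong[of _ _ 0] fun_cong[of _ _ 1])
  have "card (P_vertices (Suc n)) = 4 + 2 * card (P_vertices n)"
    unfolding P_vertices.simps
    using card_Un_disjoint[OF _ _ A] card_Un_disjoint[OF _ _ ee] A4 by (simp add: card_image inj)
  then show ?case using Suc by simp
qed simp

section \<open>Self-polarity\<close>

text \<open>\<open>A\<close> and \<open>B\<close> stand for the norms of two vectors, and the
  product on the left bounds the contribution of their tails. With \<open>x1 = x0 + s\<close> and
  \<open>y1 = y0 + t\<close> the claim becomes x0 t - s y0 \<le> A |t| + B |s| - |s| |t|. In each
  sign pattern the bound on \<open>x1\<close> or on \<open>y1\<close> sharpens one of the two
  factors by exactly what yields the term |s| |t|.\<close>

lemma plane_form_bound:
  fixes x0 x1 y0 y1 A B :: real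
  assumes "\<bar>x0\<bar> \<le> A" "\<bar>x1\<bar> \<le> A" "\<bar>y0\<bar> \<le> B" "\<bar>y1\<bar> \<le> B" "\<bar>x0 - x1\<bar> \<le> A" "\<bar>y0 - y1\<bar> \<le> B"
  shows "x0 * y1 - x1 * y0 + (A - \<bar>x0 - x1\<bar>) * (B - \<bar>y0 - y1\<bar>) \<le> A * B"
proof -
  define s where "s = x1 - x0"
  define t where "t = y1 - y0"
  have x1: "x1 = x0 + s" and y1: "y1 = y0 + t" by (simp_all add: s_def t_def)
  note bounds = assms[unfolded x1 y1]
  consider "s \<ge> 0" "t \<ge> 0" | "s \<ge> 0" "t \<le> 0" | "s \<le> 0" "t \<ge> 0" | "s \<le> 0" "t \<le> 0" by linarith
  then have "x0 * t - s * y0 \<le> A * \<bar>t\<bar> + \<bar>s\<bar> * B - \<bar>s\<bar> * \<bar>t\<bar>"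
  proof cases
    case 1
    have "(x0) * (t) \<le> (A - s) * (t)" by (rule mult_right_mono) (use 1 bounds in linarith)+
    moreover have "(s) * (- y0) \<le> (s) * (B)" by (rule mult_left_mono) (use 1 bounds in linarith)+
    ultimately show ?thesis using 1 by (simp add: algebra_simps)
  next
    case 2
    have "(- x0) * (- t) \<le> (A) * (- t)" by (rule mult_right_mono) (use 2 bounds in linarith)+
    moreover have "(s) * (- y0) \<le> (s) * (B + t)" by (rule mult_left_mono) (use 2 bounds in linarith)+
    ultimately show ?thesis using 2 by (simp add: algebra_simps)
  next
    case 3
    have "(x0) * (t) \<le> (A) * (t)" by (rule mult_right_mono) (use 3 bounds in linarith)+
    moreover have "(- s) * (y0) \<le> (- s) * (B - t)" by (rule mult_left_mono) (use 3 bounds in linarith)+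
    ultimately show ?thesis using 3 by (simp add: algebra_simps)
  next
    case 4
    have "(- x0) * (- t) \<le> (A + s) * (- t)" by (rule mult_right_mono) (use 4 bounds in linarith)+
    moreover have "(- s) * (y0) \<le> (- s) * (B)" by (rule mult_left_mono) (use 4 bounds in linarith)+
    ultimately show ?thesis using 4 by (simp add: algebra_simps)
  qed
  then show ?thesis by (simp add: x1 y1 algebra_simps)
qed

text \<open>The Hoelder type half of self-duality. By induction the tails contribute at most the
  product of what the norms leave after |x0 - x1| and |y0 - y1|; the plane inequality absorbs
  it.\<close>

lemma omega_le_P_norm: "x \<in> R2n n \<Longrightarrow> y \<in> R2n n \<Longrightarrow> omega n x y \<le> P_norm n x * P_norm n y"
proof (induction n arbitrary: x y)
  case (Suc n)
  let ?A = "P_norm (Suc n) x" and ?B = "P_norm (Suc n) y"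
  have "omega n (tail x) (tail y) \<le> P_norm n (tail x) * P_norm n (tail y)"
    using Suc by (simp add: tail_mem_R2n)
  also have "\<dots> \<le> (?A - \<bar>x 0 - x 1\<bar>) * (?B - \<bar>y 0 - y 1\<bar>)"
  proof (intro mult_mono)
    have *: "P_norm n (tail z) \<le> P_norm (Suc n) z - \<bar>z 0 - z 1\<bar>" for z
      by (simp add: algebra_simps)
    show "P_norm n (tail x) \<le> ?A - \<bar>x 0 - x 1\<bar>" "P_norm n (tail y) \<le> ?B - \<bar>y 0 - y 1\<bar>"
      by (rule *)+
    show "0 \<le> ?A - \<bar>x 0 - x 1\<bar>"
      using *[of x] P_norm_nonneg[of n "tail x"] by linarith
  qed simp
  finally have "omega (Suc n) x y \<le> x 0 * y 1 - x 1 * y 0 + (?A - \<bar>x 0 - x 1\<bar>) * (?B - \<bar>y 0 - y 1\<bar>)"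
    by (simp only: omega_Suc)
  also have "\<dots> \<le> ?A * ?B"
    using P_norm_nonneg[of n "tail x"] P_norm_nonneg[of n "tail y"]
    by (intro plane_form_bound) (auto simp: le_max_iff_disj simp del: P_norm_nonneg)
  finally show ?case .
qed simp

text \<open>The other half of self-duality: each of the three terms in the maximum is attained, up
  to sign, at (0, 1), at (1, 0), or at a lift over \<open>e\<close> or \<open>- e\<close> of the
  point that attains the norm of the tail.\<close>

lemma P_norm_attained: "y \<in> R2n n \<Longrightarrow> \<exists>x\<in>P_ball n. omega n x y = P_norm n y"
proof (induction n arbitrary: y)
  case (Suc n)
  have pm: "\<exists>x\<in>P_ball (Suc n). omega (Suc n) x y = \<bar>c\<bar>"
    if "x \<in> P_ball (Suc n)" "omega (Suc n) x y = c" for x c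
  proof (cases "c \<ge> 0")
    case True
    then show ?thesis using that by (intro bexI[of _ x]) auto
  next
    case False
    then show ?thesis using that by (intro bexI[of _ "- x"]) auto
  qed
  obtain w where w: "w \<in> P_ball n" "omega n w (tail y) = P_norm n (tail y)"
  proof -
    have "tail y \<in> R2n n" using Suc.prems by (simp only: tail_mem_R2n)
    then show ?thesis using Suc.IH that by blast
  qed
  have "\<exists>x\<in>P_ball (Suc n). omega (Suc n) x y = \<bar>y 0\<bar>"
    by (intro pm[of "- plane_vec 0 1"]) (auto simp: P_ball_Suc omega_Suc)
  moreover have "\<exists>x\<in>P_ball (Suc n). omega (Suc n) x y = \<bar>y 1\<bar>"
    by (intro pm[of "plane_vec 1 0"]) (auto simp: P_ball_Suc omega_Suc)
  moreover have "\<exists>x\<in>P_ball (Suc n). omega (Suc n) x y = \<bar>y 0 - y 1\<bar> + P_norm n (tail y)"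
  proof (cases "y 0 \<le> y 1")
    case True
    then show ?thesis
      using w by (intro bexI[of _ "join e w"]) (auto simp: P_ball_Suc omega_Suc, auto simp: P_ball_def)
  next
    case False
    then show ?thesis
      using w by (intro bexI[of _ "join (- e) w"]) (auto simp: P_ball_Suc omega_Suc, auto simp: P_ball_def)
  qed
  moreover have "P_norm (Suc n) y \<in> {\<bar>y 0\<bar>, \<bar>y 1\<bar>, \<bar>y 0 - y 1\<bar> + P_norm n (tail y)}"
    by (auto simp: max_def)
  ultimately show ?case by auto
qed (auto simp: P_ball_0)

lemma P_ball_self_polar: "P_ball n = omega_polar n (P_ball n)"
proof (intro set_eqI iffI)
  fix y assume y: "y \<in> P_ball n"
  have "omega n x y \<le> 1" if "x \<in> P_ball n" for x
  proof -
    have "omega n x y \<le> P_norm n x * P_norm n y"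
      using y that by (intro omega_le_P_norm) (auto simp: P_ball_def)
    also have "\<dots> \<le> 1" using y that by (intro mult_le_one) (auto simp: P_ball_def)
    finally show ?thesis .
  qed
  then show "y \<in> omega_polar n (P_ball n)" using y by (simp add: omega_polar_def P_ball_def)
next
  fix y assume "y \<in> omega_polar n (P_ball n)"
  then show "y \<in> P_ball n"
    using P_norm_attained[of y n] by (force simp: omega_polar_def P_ball_def)
qed

section \<open>Compactness and the interior\<close>

lemma P_norm_coordinate: "i < 2 * n \<Longrightarrow> \<bar>x i\<bar> \<le> P_norm n x"
proof (induction n arbitrary: x i)
  case (Suc n)
  show ?case
  proof (cases "i < 2")
    case True
    then show ?thesis by (auto simp: less_2_cases_iff)
  next
    case False
    then obtain j where j: "i = j + 2" by (metis add.commute le_Suc_ex not_less)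
    have "\<bar>tail x j\<bar> \<le> P_norm n (tail x)"
      using Suc.prems j by (intro Suc.IH) simp
    then have "\<bar>x i\<bar> \<le> P_norm n (tail x)"
      by (simp only: tail_apply j)
    then show ?thesis by (auto simp: le_max_iff_disj)
  qed
qed simp

text \<open>The ball is closed in the product topology and lies in the cube with sides [-1, 1],
  which is compact by Tychonoff's theorem.\<close>

lemma compact_P_ball: "compactin (Euclidean_space (2 * n)) (P_ball n)"
proof -
  have "\<bar>x i\<bar> \<le> 1" if "x \<in> P_ball n" for x i
    using that P_norm_coordinate[of i n x] by (cases "i < 2 * n") (auto simp: P_ball_def mem_R2n)
  then have sub: "P_ball n \<subseteq> PiE UNIV (\<lambda>i. {-1..1})"
    by (fastforce simp: PiE_def abs_le_iff)
  have "R2n n = (\<Inter>i\<in>{2 * n..}. {x. x i = 0})" by (auto simp: mem_R2n)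
  also have "closed \<dots>"
    by (intro closed_INT ballI closed_Collect_eq continuous_on_product_coordinates continuous_on_const)
  finally have "closed (R2n n)" .
  moreover have "closed {x. P_norm n x \<le> 1}"
    by (intro closed_Collect_le continuous_on_P_norm continuous_on_const)
  ultimately have "closed (P_ball n)"
    unfolding P_ball_def Collect_conj_eq by (simp add: closed_Int)
  moreover have "compact (PiE UNIV (\<lambda>i::nat. {-1..1::real}))"
    unfolding compactin_euclidean_iff[symmetric] euclidean_product_topology[symmetric]
    by (simp add: compactin_PiE)
  ultimately have "compact (P_ball n)"
    using sub by (metis closed_Int_compact inf.absorb_iff1)
  moreover have "P_ball n \<subseteq> {x. \<forall>i\<ge>2 * n. x i = 0}" by (auto simp: P_ball_def mem_R2n)
  ultimately show ?thesis
    unfolding Euclidean_space_def compactin_subtopology euclidean_product_topology compactin_euclidean_iff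
    by blast
qed

lemma zero_interior_P_ball: "0 \<in> Euclidean_space (2 * n) interior_of P_ball n"
proof -
  have "open {x. P_norm n x < 1}"
    by (intro open_Collect_less continuous_on_P_norm continuous_intros)
  then have "openin (Euclidean_space (2 * n)) ({x. P_norm n x < 1} \<inter> {x. \<forall>i\<ge>2 * n. x i = 0})"
    unfolding Euclidean_space_def euclidean_product_topology openin_subtopology open_openin[symmetric]
    by blast
  also have "{x. P_norm n x < 1} \<inter> {x. \<forall>i\<ge>2 * n. x i = 0} = {x \<in> R2n n. P_norm n x < 1}"
    by (auto simp: mem_R2n)
  finally have "openin (Euclidean_space (2 * n)) {x \<in> R2n n. P_norm n x < 1}" .
  moreover have "{x \<in> R2n n. P_norm n x < 1} \<subseteq> P_ball n" by (auto simp: P_ball_def)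
  moreover have "0 \<in> {x \<in> R2n n. P_norm n x < 1}" by simp
  ultimately show ?thesis unfolding interior_of_def by blast
qed

lemma symplectically_self_polar_P_ball: "symplectically_self_polar n (P_ball n)"
  unfolding symplectically_self_polar_def
  by (intro conjI convex_P_ball compact_P_ball zero_interior_P_ball P_ball_self_polar)

subsection \<open>Volume\<close>

lemma P_norm_cong: "(\<And>i. i < 2 * n \<Longrightarrow> x i = y i) \<Longrightarrow> P_norm n x = P_norm n y"
proof (induction n arbitrary: x y)
  case (Suc n)
  have "P_norm n (tail x) = P_norm n (tail y)"
    by (rule Suc.IH) (simp add: tail_apply Suc.prems)
  then show "P_norm (Suc n) x = P_norm (Suc n) y"
    using Suc.prems[of 0] Suc.prems[of 1] by simp
qed simp

lemma tail_shift: "tail (\<lambda>i. x (i + j)) = (\<lambda>i. x (i + (j + 2)))"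
  by (simp add: tail_def algebra_simps)

text \<open>Reading the norm from index \<open>j\<close> on lets the induction drop two leading
  coordinates without renaming the remaining indices of the product space.\<close>

lemma P_norm_shift_measurable:
  assumes "{j..<j + 2 * n} \<subseteq> I"
  shows "(\<lambda>x. P_norm n (\<lambda>i. x (i + j))) \<in> borel_measurable (PiM I (\<lambda>_. lborel))"
  using assms
proof (induction n arbitrary: j)
  case (Suc n)
  have [measurable]: "(\<lambda>x. P_norm n (\<lambda>i. x (i + (j + 2)))) \<in> borel_measurable (PiM I (\<lambda>_. lborel))"
    using Suc.prems by (intro Suc.IH) auto
  have "(\<lambda>x. x i) \<in> borel_measurable (PiM I (\<lambda>_. lborel :: real measure))" if "i \<in> I" for i
    using measurable_component_singleton[OF that, of "\<lambda>_. lborel :: real measure"] by simp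
  moreover have "j \<in> I" "Suc j \<in> I" using Suc.prems by auto
  ultimately have [measurable]: "(\<lambda>x. x (0 + j)) \<in> borel_measurable (PiM I (\<lambda>_. lborel :: real measure))"
      "(\<lambda>x. x (1 + j)) \<in> borel_measurable (PiM I (\<lambda>_. lborel :: real measure))"
    by simp_all
  show ?case unfolding P_norm.simps tail_shift
    by (intro borel_measurable_max borel_measurable_add borel_measurable_abs borel_measurable_diff) fact+
qed simp

section \<open>The integral over the hexagon\<close>

lemma nn_integral_suspension_profile_half:
  fixes r :: real
  assumes "r \<ge> 0"
  shows "(\<integral>\<^sup>+s. ennreal ((r - s) ^ m * (2 * r - s)) * indicator {0..r} s \<partial>lborel)
     = ennreal (r ^ (m + 2) * (1 / real (m + 1) + 1 / real (m + 2)))"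
proof -
  \<comment> \<open>The antiderivative from splitting \<open>2 * r - s\<close> as
    \<open>r + (r - s)\<close>.\<close>
  define F where "F s = - (r * (r - s) ^ (m + 1) / real (m + 1) + (r - s) ^ (m + 2) / real (m + 2))" for s
  have "(\<integral>\<^sup>+s. ennreal ((r - s) ^ m * (2 * r - s)) * indicator {0..r} s \<partial>lborel) = ennreal (F r - F 0)"
  proof (rule nn_integral_FTC_Icc[where F = F and f = "\<lambda>s. (r - s) ^ m * (2 * r - s)"])
    fix s assume s: "s \<in> {0..r}"
    have "(F has_real_derivative r * (r - s) ^ m + (r - s) ^ (m + 1)) (at s)"
      unfolding F_def by (rule derivative_eq_intros refl | simp)+
    also have "r * (r - s) ^ m + (r - s) ^ (m + 1) = (r - s) ^ m * (2 * r - s)"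
      by (simp add: algebra_simps)
    finally show "(F has_real_derivative (r - s) ^ m * (2 * r - s)) (at s)" .
    show "0 \<le> (r - s) ^ m * (2 * r - s)" using s assms by simp
  qed (use assms in auto)
  also have "F r - F 0 = r ^ (m + 2) * (1 / real (m + 1) + 1 / real (m + 2))"
    by (simp add: F_def algebra_simps)
  finally show ?thesis .
qed

lemma nn_integral_suspension_profile:
  fixes r :: real
  assumes "r \<ge> 0"
  shows "(\<integral>\<^sup>+s. ennreal ((r - \<bar>s\<bar>) ^ m * (2 * r - \<bar>s\<bar>)) * indicator {-r..r} s \<partial>lborel)
     = ennreal (2 * r ^ (m + 2) * (1 / real (m + 1) + 1 / real (m + 2)))"
proof -
  let ?f = "\<lambda>s. ennreal ((r - \<bar>s\<bar>) ^ m * (2 * r - \<bar>s\<bar>))"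
  let ?I = "r ^ (m + 2) * (1 / real (m + 1) + 1 / real (m + 2))"
  have "(\<integral>\<^sup>+s. ?f s * indicator {-r..r} s \<partial>lborel)
      = (\<integral>\<^sup>+s. ?f s * indicator {0..r} s + ?f s * indicator {-r..0} s \<partial>lborel)"
    using AE_lborel_singleton[of 0] assms
    by (intro nn_integral_cong_AE) (auto split: split_indicator)
  also have "\<dots> = (\<integral>\<^sup>+s. ?f s * indicator {0..r} s \<partial>lborel) + (\<integral>\<^sup>+s. ?f s * indicator {-r..0} s \<partial>lborel)"
    by (intro nn_integral_add) auto
  also have "(\<integral>\<^sup>+s. ?f s * indicator {-r..0} s \<partial>lborel) = (\<integral>\<^sup>+s. ?f s * indicator {0..r} s \<partial>lborel)"
    by (subst nn_integral_real_affine[where c = "-1" and t = 0])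
      (auto intro!: nn_integral_cong split: split_indicator)
  also have "(\<integral>\<^sup>+s. ?f s * indicator {0..r} s \<partial>lborel) = ennreal ?I"
    unfolding nn_integral_suspension_profile_half[OF assms, of m, symmetric]
    by (intro nn_integral_cong) (auto split: split_indicator)
  also have "ennreal ?I + ennreal ?I = ennreal (2 * ?I)"
    using assms by (subst ennreal_plus[symmetric]) auto
  finally show ?thesis by (simp add: mult.assoc)
qed

text \<open>The integrand is the \<open>m\<close>-th power of the radius left for the tail over the
  point (a, b). The shear \<open>b = a + s\<close> makes it depend on \<open>s\<close> alone, and
  the \<open>a\<close> with both \<open>a\<close> and \<open>a + s\<close> in [-r, r] form an
  interval of length \<open>2 * r - \<bar>s\<bar>\<close>.\<close>

lemma nn_integral_suspension:
  fixes r :: real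
  assumes "r \<ge> 0"
  shows "(\<integral>\<^sup>+a. (\<integral>\<^sup>+b. indicator {-r..r} a * (indicator {-r..r} b *
            (if \<bar>a - b\<bar> \<le> r then ennreal ((r - \<bar>a - b\<bar>) ^ m) else 0)) \<partial>lborel) \<partial>lborel)
     = ennreal (2 * r ^ (m + 2) * (1 / real (m + 1) + 1 / real (m + 2)))" (is "?L = _")
proof -
  let ?g = "\<lambda>a s. indicator {-r..r} a * (indicator {-r..r} (a + s) *
            (if \<bar>s\<bar> \<le> r then ennreal ((r - \<bar>s\<bar>) ^ m) else 0))"
  have "?L = (\<integral>\<^sup>+a. (\<integral>\<^sup>+s. ?g a s \<partial>lborel) \<partial>lborel)"
  proof (rule nn_integral_cong)
    fix a
    let ?h = "\<lambda>b. indicator {-r..r} a * (indicator {-r..r} b *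
            (if \<bar>a - b\<bar> \<le> r then ennreal ((r - \<bar>a - b\<bar>) ^ m) else 0))"
    have "?h \<in> borel_measurable borel" by measurable
    from nn_integral_real_affine[OF this, of 1 a]
    show "(\<integral>\<^sup>+b. ?h b \<partial>lborel) = (\<integral>\<^sup>+s. ?g a s \<partial>lborel)" by (simp cong: if_cong)
  qed
  also have "\<dots> = (\<integral>\<^sup>+s. (\<integral>\<^sup>+a. ?g a s \<partial>lborel) \<partial>lborel)"
    by (rule lborel_pair.Fubini') measurable
  also have "\<dots> = (\<integral>\<^sup>+s. ennreal ((r - \<bar>s\<bar>) ^ m * (2 * r - \<bar>s\<bar>)) * indicator {-r..r} s \<partial>lborel)"
  proof (rule nn_integral_cong)
    fix s
    have "(\<integral>\<^sup>+a. ?g a s \<partial>lborel) = (\<integral>\<^sup>+a. (if \<bar>s\<bar> \<le> r then ennreal ((r - \<bar>s\<bar>) ^ m) else 0)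
        * indicator {max (-r) (-r - s)..min r (r - s)} a \<partial>lborel)"
      by (intro nn_integral_cong) (auto split: split_indicator)
    also have "\<dots> = (if \<bar>s\<bar> \<le> r then ennreal ((r - \<bar>s\<bar>) ^ m) else 0)
        * emeasure lborel {max (-r) (-r - s)..min r (r - s)}"
      by (rule nn_integral_cmult_indicator) simp
    also have "\<dots> = ennreal ((r - \<bar>s\<bar>) ^ m * (2 * r - \<bar>s\<bar>)) * indicator {-r..r} s"
    proof (cases "\<bar>s\<bar> \<le> r")
      case True
      then have "max (-r) (-r - s) \<le> min r (r - s)" "min r (r - s) - max (-r) (-r - s) = 2 * r - \<bar>s\<bar>"
        by (auto simp: min_def max_def)
      moreover have "s \<in> {-r..r}" using True by auto
      ultimately show ?thesis using True by (simp add: ennreal_mult)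
    qed (auto split: split_indicator)
    finally show "(\<integral>\<^sup>+a. ?g a s \<partial>lborel) = \<dots>" .
  qed
  finally show ?thesis unfolding nn_integral_suspension_profile[OF assms] .
qed

text \<open>The factor is the hexagon integral for \<open>r = 1\<close> and
  \<open>m = 2 * n\<close>, the dimension of the tail.\<close>

primrec P_volume :: "nat \<Rightarrow> real" where
  "P_volume 0 = 1"
| "P_volume (Suc n) = 2 * (1 / (2 * n + 1) + 1 / (2 * n + 2)) * P_volume n"

lemma P_volume_nonneg: "P_volume n \<ge> 0"
  by (induction n) auto

interpretation lborel_product: product_sigma_finite "\<lambda>_::nat. lborel :: real measure"
  by standard

text \<open>Radius and offset are arbitrary because fixing the first two coordinates
  \<open>a\<close>, \<open>b\<close> leaves a ball of radius \<open>r - \<bar>a - b\<bar>\<close> in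
  the coordinates from \<open>j + 2\<close> on.\<close>

lemma emeasure_P_norm_le:
  assumes "r \<ge> 0"
  shows "emeasure (PiM {j..<j + 2 * n} (\<lambda>_. lborel))
      {x \<in> space (PiM {j..<j + 2 * n} (\<lambda>_. lborel)). P_norm n (\<lambda>i. x (i + j)) \<le> r}
    = ennreal (P_volume n * r ^ (2 * n))"
  using assms
proof (induction n arbitrary: j r)
  case 0
  then show ?case by (simp add: space_PiM_empty)
next
  case (Suc n)
  define I where "I = {j + 2..<j + 2 + 2 * n}"
  have J: "{j..<j + 2 * Suc n} = insert j (insert (j + 1) I)" by (auto simp: I_def)
  have I: "finite I" "j + 1 \<notin> I" "j \<notin> insert (j + 1) I" by (auto simp: I_def)
  define f :: "(nat \<Rightarrow> real) \<Rightarrow> ennreal" where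
    "f x = indicator {x. P_norm (Suc n) (\<lambda>i. x (i + j)) \<le> r} x" for x
  have meas: "(\<lambda>x. P_norm (Suc n) (\<lambda>i. x (i + j))) \<in> borel_measurable (PiM (insert j (insert (j + 1) I)) (\<lambda>_. lborel))"
    by (rule P_norm_shift_measurable) (simp only: J)
  have f[measurable]: "f \<in> borel_measurable (PiM (insert j (insert (j + 1) I)) (\<lambda>_. lborel))"
    unfolding f_def indicator_def using meas by measurable
  have meas': "(\<lambda>x. P_norm n (\<lambda>i. x (i + (j + 2)))) \<in> borel_measurable (PiM I (\<lambda>_. lborel))"
    by (rule P_norm_shift_measurable) (simp add: I_def)
  have upd: "(\<lambda>x. x(j := a)) \<in> measurable (PiM (insert (j + 1) I) (\<lambda>_. lborel)) (PiM (insert j (insert (j + 1) I)) (\<lambda>_. lborel))"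
    for a :: real
    by (rule measurable_fun_upd[where J = "insert (j + 1) I"]) auto
  have f_upd: "f (x(j + 1 := b, j := a)) = indicator {-r..r} a * (indicator {-r..r} b *
      indicator {x. P_norm n (\<lambda>i. x (i + (j + 2))) \<le> r - \<bar>a - b\<bar>} x)" for x a b
  proof -
    have "P_norm n (\<lambda>i. (x(j + 1 := b, j := a)) (i + (j + 2))) = P_norm n (\<lambda>i. x (i + (j + 2)))"
      by (rule P_norm_cong) simp
    then have "P_norm (Suc n) (\<lambda>i. (x(j + 1 := b, j := a)) (i + j)) \<le> r \<longleftrightarrow>
        \<bar>a\<bar> \<le> r \<and> \<bar>b\<bar> \<le> r \<and> P_norm n (\<lambda>i. x (i + (j + 2))) \<le> r - \<bar>a - b\<bar>"
      unfolding P_norm.simps tail_shift by auto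
    then show ?thesis unfolding f_def by (auto split: split_indicator)
  qed
  \<comment> \<open>Where |a - b| exceeds \<open>r\<close> the remaining radius is negative and the
    slice is empty; hence the case distinction.\<close>
  have inner: "(\<integral>\<^sup>+x. indicator {x. P_norm n (\<lambda>i. x (i + (j + 2))) \<le> q} x \<partial>PiM I (\<lambda>_. lborel))
      = (if 0 \<le> q then ennreal (P_volume n) * ennreal (q ^ (2 * n)) else 0)" for q
  proof (cases "0 \<le> q")
    case True
    have "(\<integral>\<^sup>+x. indicator {x. P_norm n (\<lambda>i. x (i + (j + 2))) \<le> q} x \<partial>PiM I (\<lambda>_. lborel))
        = (\<integral>\<^sup>+x. indicator {x \<in> space (PiM I (\<lambda>_. lborel)). P_norm n (\<lambda>i. x (i + (j + 2))) \<le> q} x \<partial>PiM I (\<lambda>_. lborel))"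
      by (intro nn_integral_cong) (auto split: split_indicator)
    also have "\<dots> = emeasure (PiM I (\<lambda>_. lborel)) {x \<in> space (PiM I (\<lambda>_. lborel)). P_norm n (\<lambda>i. x (i + (j + 2))) \<le> q}"
      by (intro nn_integral_indicator borel_measurable_le meas') simp
    also have "\<dots> = ennreal (P_volume n * q ^ (2 * n))"
      unfolding I_def by (rule Suc.IH[OF True])
    finally show ?thesis using True P_volume_nonneg by (simp add: ennreal_mult)
  next
    case False
    then have "\<not> P_norm n y \<le> q" for y using P_norm_nonneg[of n y] by linarith
    then show ?thesis using False by simp
  qed
  have "emeasure (PiM {j..<j + 2 * Suc n} (\<lambda>_. lborel))
      {x \<in> space (PiM {j..<j + 2 * Suc n} (\<lambda>_. lborel)). P_norm (Suc n) (\<lambda>i. x (i + j)) \<le> r}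
    = (\<integral>\<^sup>+x. indicator {x \<in> space (PiM (insert j (insert (j + 1) I)) (\<lambda>_. lborel)). P_norm (Suc n) (\<lambda>i. x (i + j)) \<le> r} x
        \<partial>PiM (insert j (insert (j + 1) I)) (\<lambda>_. lborel))"
    unfolding J by (intro nn_integral_indicator[symmetric] borel_measurable_le meas) simp
  also have "\<dots> = (\<integral>\<^sup>+x. f x \<partial>PiM (insert j (insert (j + 1) I)) (\<lambda>_. lborel))"
    by (intro nn_integral_cong) (auto simp: f_def split: split_indicator)
  also have "\<dots> = (\<integral>\<^sup>+a. (\<integral>\<^sup>+x. f (x(j := a)) \<partial>PiM (insert (j + 1) I) (\<lambda>_. lborel)) \<partial>lborel)"
    using I by (intro lborel_product.product_nn_integral_insert_rev f) auto
  also have "\<dots> = (\<integral>\<^sup>+a. (\<integral>\<^sup>+b. (\<integral>\<^sup>+x. f (x(j + 1 := b, j := a)) \<partial>PiM I (\<lambda>_. lborel)) \<partial>lborel) \<partial>lborel)"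
    using I by (intro nn_integral_cong lborel_product.product_nn_integral_insert_rev
      measurable_compose[OF upd f]) auto
  also have "\<dots> = (\<integral>\<^sup>+a. (\<integral>\<^sup>+b. ennreal (P_volume n) * (indicator {-r..r} a * (indicator {-r..r} b *
      (if \<bar>a - b\<bar> \<le> r then ennreal ((r - \<bar>a - b\<bar>) ^ (2 * n)) else 0))) \<partial>lborel) \<partial>lborel)"
  proof (intro nn_integral_cong)
    fix a b
    have "(\<integral>\<^sup>+x. f (x(j + 1 := b, j := a)) \<partial>PiM I (\<lambda>_. lborel)) = indicator {-r..r} a * (indicator {-r..r} b *
      (\<integral>\<^sup>+x. indicator {x. P_norm n (\<lambda>i. x (i + (j + 2))) \<le> r - \<bar>a - b\<bar>} x \<partial>PiM I (\<lambda>_. lborel)))"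
      unfolding f_upd using meas'
      by (subst nn_integral_cmult, unfold indicator_def, measurable)+ 
    then show "(\<integral>\<^sup>+x. f (x(j + 1 := b, j := a)) \<partial>PiM I (\<lambda>_. lborel))
       = ennreal (P_volume n) * (indicator {-r..r} a * (indicator {-r..r} b *
      (if \<bar>a - b\<bar> \<le> r then ennreal ((r - \<bar>a - b\<bar>) ^ (2 * n)) else 0)))"
      unfolding inner by (auto split: split_indicator)
  qed
  also have "\<dots> = ennreal (P_volume n) * ennreal (2 * r ^ (2 * n + 2) * (1 / real (2 * n + 1) + 1 / real (2 * n + 2)))"
    unfolding nn_integral_suspension[OF Suc.prems, symmetric]
    by (simp add: nn_integral_cmult)
  also have "\<dots> = ennreal (P_volume (Suc n) * r ^ (2 * Suc n))"
    using Suc.prems by (simp add: ennreal_mult[symmetric] P_volume_nonneg mult_ac add_ac)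
  finally show ?case .
qed

lemma vol_P_ball: "vol n (P_ball n) = P_volume n"
proof -
  have "(\<lambda>x. restrict x {..<2 * n}) ` P_ball n = {x \<in> space (PiM {..<2 * n} (\<lambda>_. lborel)). P_norm n x \<le> 1}"
    (is "?L = ?R")
  proof (intro set_eqI iffI)
    fix x assume "x \<in> ?L"
    then obtain y where y: "y \<in> P_ball n" "x = restrict y {..<2 * n}" by blast
    then have "P_norm n x = P_norm n y" by (intro P_norm_cong) simp
    then show "x \<in> ?R" using y by (auto simp: P_ball_def space_PiM)
  next
    fix x assume x: "x \<in> ?R"
    \<comment> \<open>Extension by zero inverts the restriction, whose values off the index set are
      \<open>undefined\<close>.\<close>
    define y where "y i = (if i < 2 * n then x i else 0)" for i
    have "P_norm n y = P_norm n x" by (rule P_norm_cong) (simp add: y_def)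
    then have "y \<in> P_ball n" using x by (simp add: P_ball_def mem_R2n y_def)
    moreover have "x = restrict y {..<2 * n}"
      using x by (auto simp: y_def space_PiM PiE_def extensional_def)
    ultimately show "x \<in> ?L" by blast
  qed
  then show ?thesis
    unfolding vol_def measure_def using emeasure_P_norm_le[of 1 0 n] P_volume_nonneg[of n]
    by (simp add: atLeast0LessThan)
qed

text \<open>The factor of the recursion is 2 / (n + 1) times (n + 3/4) / (n + 1/2), so each step is
  the functional equation of Gamma at n + 3/4 and n + 1/2.\<close>

lemma P_volume_eq_Gamma:
  "P_volume n = 2 ^ n / fact n * (Gamma (real n + 3 / 4) / Gamma (real n + 1 / 2))
        * (Gamma (1 / 2) / Gamma (3 / 4))"
proof (induction n)
  case 0
  have "Gamma (1 / 2 :: real) \<noteq> 0" "Gamma (3 / 4 :: real) \<noteq> 0"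
    by (simp_all add: Gamma_real_pos_exp)
  then show ?case by simp
next
  case (Suc n)
  have rec: "Gamma (real (Suc n) + c) = (real n + c) * Gamma (real n + c)" if "c > 0" for c :: real
  proof -
    have "real n + c \<notin> \<int>\<^sub>\<le>\<^sub>0" using that by (auto elim!: nonpos_Ints_cases)
    then show ?thesis using Gamma_plus1[of "real n + c"] by (simp add: add_ac)
  qed
  have "2 * (1 / (2 * real n + 1) + 1 / (2 * real n + 2))
      = 2 / (real n + 1) * ((real n + 3 / 4) / (real n + 1 / 2))"
    by (simp add: divide_simps) (simp add: algebra_simps)
  then have "P_volume (Suc n) = 2 / (real n + 1) * ((real n + 3 / 4) / (real n + 1 / 2)) *
      (2 ^ n / fact n * (Gamma (real n + 3 / 4) / Gamma (real n + 1 / 2)) * (Gamma (1 / 2) / Gamma (3 / 4)))"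
    by (simp only: P_volume.simps Suc.IH)
  also have "\<dots> = 2 ^ Suc n / fact (Suc n) * ((real n + 3 / 4) * Gamma (real n + 3 / 4)
      / ((real n + 1 / 2) * Gamma (real n + 1 / 2))) * (Gamma (1 / 2) / Gamma (3 / 4))"
    by (simp add: mult_ac add_ac)
  also have "\<dots> = 2 ^ Suc n / fact (Suc n) * (Gamma (real (Suc n) + 3 / 4)
      / Gamma (real (Suc n) + 1 / 2)) * (Gamma (1 / 2) / Gamma (3 / 4))"
    by (subst (1 2) rec) simp_all
  finally show ?case .
qed

subsection \<open>Capacity\<close>

text \<open>Defined on all sequences and reading only the first two entries, this is both the
  identification of the plane with \<open>real^2\<close> and the projection onto it.\<close>

definition vec2 :: "(nat \<Rightarrow> real) \<Rightarrow> real ^ 2" where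
  "vec2 x = (\<chi> i. if i = 1 then x 0 else x 1)"

lemma vec2_nth [simp]: "vec2 x $ 1 = x 0" "vec2 x $ 2 = x 1"
  by (simp_all add: vec2_def)

lemma vec2_plane_vec [simp]: "vec2 (plane_vec (y $ 1) (y $ 2)) = y"
  by (simp add: vec_eq_iff forall_2)

lemma linear_vec2: "linear vec2"
  by (simp add: linear_iff vec_eq_iff forall_2)

text \<open>Pairing with a vector of the first plane sees only the projection to that plane; this is
  the duality between sections and projections.\<close>

lemma omega_plane_vec: "n \<ge> 1 \<Longrightarrow> omega n x (plane_vec (y $ 1) (y $ 2)) = det2 (vec2 x) y"
  by (cases n) (simp_all add: omega_Suc det2_def)

section \<open>Transfer of planar area to \<open>real^2\<close>\<close>

lemma vec2_measurable: "vec2 \<in> borel_measurable (PiM {..<2} (\<lambda>_. lborel))"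
proof -
  have comp: "(\<lambda>x. x i) \<in> borel_measurable (PiM {..<2} (\<lambda>_. lborel :: real measure))" if "i < 2" for i :: nat
    using measurable_component_singleton[of i "{..<2}" "\<lambda>_. lborel :: real measure"] that by simp
  have "(\<lambda>x. vec2 x $ k) \<in> borel_measurable (PiM {..<2} (\<lambda>_. lborel))" for k
    using comp[of 0] comp[of 1] exhaust_2[of k] by auto
  then show ?thesis
    unfolding borel_measurable_euclidean_space[of vec2] by (auto simp: Basis_vec_def inner_axis)
qed

text \<open>Lebesgue measure is determined by its values on boxes, whose preimages are products of
  two intervals.\<close>

lemma lborel_vec2: "lborel = distr (PiM {..<2} (\<lambda>_. lborel)) borel vec2"
proof (rule lborel_eqI)
  fix l u :: "real ^ 2"
  assume le: "\<And>b. b \<in> Basis \<Longrightarrow> l \<bullet> b \<le> u \<bullet> b"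
  interpret finite_product_sigma_finite "\<lambda>_::nat. lborel :: real measure" "{..<2}"
    by standard auto
  have all_less_two: "(\<forall>i<2. Q i) \<longleftrightarrow> Q 0 \<and> Q 1" for Q :: "nat \<Rightarrow> bool"
    by (auto simp: less_2_cases_iff)
  have Basis2: "Basis = {axis 1 1, axis 2 1 :: real ^ 2}"
    by (auto simp: Basis_vec_def UNIV_2)
  have le2: "l $ 1 \<le> u $ 1" "l $ 2 \<le> u $ 2"
    using le[of "axis 1 1"] le[of "axis 2 1"] by (simp_all add: Basis2 inner_axis)
  define I where "I i = {plane_vec (l $ 1) (l $ 2) i<..<plane_vec (u $ 1) (u $ 2) i}" for i
  have "vec2 -` box l u \<inter> space (PiM {..<2} (\<lambda>_. lborel)) = PiE {..<2} I"
  proof -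
    have "vec2 x \<in> box l u \<longleftrightarrow> (\<forall>i<2. x i \<in> I i)" for x
      by (auto simp: box_def Basis2 inner_axis I_def all_less_two)
    then show ?thesis by (auto simp: space_PiM PiE_iff)
  qed
  then have "emeasure (distr (PiM {..<2} (\<lambda>_. lborel)) borel vec2) (box l u)
      = emeasure (PiM {..<2} (\<lambda>_. lborel)) (PiE {..<2} I)"
    by (simp add: emeasure_distr vec2_measurable)
  also have "\<dots> = (\<Prod>i<2. emeasure lborel (I i))"
    by (rule measure_times) (simp add: I_def)
  also have "\<dots> = ennreal (u $ 1 - l $ 1) * ennreal (u $ 2 - l $ 2)"
    using le2 by (simp add: I_def numeral_2_eq_2)
  also have "\<dots> = ennreal (\<Prod>b\<in>Basis. (u - l) \<bullet> b)"
    using le2 by (simp add: Basis2 inner_axis axis_eq_axis ennreal_mult)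
  finally show "emeasure (distr (PiM {..<2} (\<lambda>_. lborel)) borel vec2) (box l u) = (\<Prod>b\<in>Basis. (u - l) \<bullet> b)" .
qed simp

lemma vol_1_plane_proj:
  assumes "vec2 ` S \<in> sets borel"
  shows "vol 1 (plane_proj ` S) = measure lborel (vec2 ` S)"
proof -
  have "(\<lambda>x. restrict x {..<2}) ` plane_proj ` S
      = vec2 -` (vec2 ` S) \<inter> space (PiM {..<2} (\<lambda>_. lborel))" (is "?L = ?R")
  proof (intro set_eqI iffI)
    fix x assume "x \<in> ?L"
    then obtain y where y: "y \<in> S" "x = restrict (plane_proj y) {..<2}" by blast
    then have "vec2 x = vec2 y" by (simp add: vec_eq_iff forall_2 plane_proj_def)
    then show "x \<in> ?R" using y by (auto simp: space_PiM)
  next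
    fix x assume x: "x \<in> ?R"
    then obtain y where y: "y \<in> S" "vec2 x = vec2 y" by auto
    then have "x 0 = y 0" "x 1 = y 1" by (metis vec2_nth)+
    then have "x = restrict (plane_proj y) {..<2}"
      using x by (auto simp: space_PiM PiE_def extensional_def plane_proj_def less_2_cases_iff fun_eq_iff)
    then show "x \<in> ?L" using y by blast
  qed
  then show ?thesis
    unfolding vol_def lborel_vec2 using assms by (simp add: measure_distr vec2_measurable)
qed

lemma plane_projection_area_ge_3:
  assumes \<phi>: "linear_symplectomorphism n \<phi>" and n: "n \<ge> 1"
  shows "3 \<le> vol 1 (plane_proj ` \<phi> ` P_ball n)"
proof -
  have lin: "linear \<phi>" and bij: "bij_betw \<phi> (R2n n) (R2n n)"
    and symp: "\<And>x y. x \<in> R2n n \<Longrightarrow> y \<in> R2n n \<Longrightarrow> omega n (\<phi> x) (\<phi> y) = omega n x y"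
    using \<phi> by (auto simp: linear_symplectomorphism_def)
  define f where "f x = vec2 (\<phi> x)" for x
  define K where "K = f ` P_ball n"
  have f: "linear f"
    unfolding f_def using linear_compose[OF lin linear_vec2] by (simp add: o_def)
  \<comment> \<open>As the hull of finitely many points of \<open>real^2\<close>, \<open>K\<close>
    is compact without a continuity argument for \<open>\<phi>\<close>.\<close>
  have K_hull: "K = convex hull (f ` P_vertices n)"
    unfolding K_def P_ball_eq_hull by (rule convex_hull_linear_image[OF f])
  have K: "compact K" "convex K"
    unfolding K_hull by (simp_all add: finite_imp_compact_convex_hull)
  have sym: "- y \<in> K" if "y \<in> K" for y
  proof -
    obtain x where "x \<in> P_ball n" "y = f x" using \<open>y \<in> K\<close> by (auto simp: K_def)
    then show ?thesis unfolding K_def by (intro image_eqI[of _ _ "- x"]) (simp_all add: linear_neg[OF f])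
  qed
  have lift: "\<exists>w\<in>R2n n. \<phi> w = plane_vec a b" for a b
    using bij plane_vec_mem_R2n[OF n, of a b] unfolding bij_betw_def by (metis imageE)
  have "0 \<in> K" unfolding K_def using linear_0[OF f] by (metis image_eqI zero_mem_P_ball)
  \<comment> \<open>A line containing \<open>K\<close> would pass through 0; but
    \<open>\<phi>\<close> maps onto the plane, so \<open>K\<close> contains a positive multiple of
    the normal vector \<open>a\<close>.\<close>
  have "interior K \<noteq> {}"
  proof
    assume "interior K = {}"
    then obtain a b where a: "a \<noteq> 0" "K \<subseteq> {x. a \<bullet> x = b}"
      using empty_interior_subset_hyperplane[OF \<open>convex K\<close>] by metis
    then have "b = 0" using \<open>0 \<in> K\<close> by auto
    obtain w where w: "w \<in> R2n n" "\<phi> w = plane_vec (a $ 1) (a $ 2)" using lift by blast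
    obtain t where t: "t > 0" "t *\<^sub>R w \<in> P_ball n" using P_ball_absorbing[OF w(1)] by blast
    have "f (t *\<^sub>R w) = t *\<^sub>R a" by (simp only: linear_scale[OF f]) (simp add: f_def w)
    then have "t *\<^sub>R a \<in> K" using t unfolding K_def by (metis image_eqI)
    then have "a \<bullet> (t *\<^sub>R a) = 0" using a \<open>b = 0\<close> by blast
    then show False using t a by simp
  qed
  then obtain c where c: "c \<in> interior K" by blast
  have "uminus ` K = K" using sym by force
  then have "- c \<in> interior K" using interior_negations[of K] c by (metis image_eqI)
  then have "(1 / 2) *\<^sub>R c + (1 / 2) *\<^sub>R (- c) \<in> interior K"
    using c by (intro convexD[OF convex_interior[OF \<open>convex K\<close>]]) auto
  then have "0 \<in> interior K" by simp
  \<comment> \<open>The preimage \<open>w\<close> of \<open>y\<close> under \<open>\<phi>\<close>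
    pairs with \<open>x\<close> as \<open>y\<close> does with \<open>f x\<close>, so
    \<open>w\<close> lies in the symplectic polar of the ball, which is the ball itself; hence
    \<open>y = f w\<close> lies in \<open>K\<close>.\<close>
  moreover have "y \<in> K" if y: "\<forall>x\<in>K. det2 x y \<le> 1" for y
  proof -
    obtain w where w: "w \<in> R2n n" "\<phi> w = plane_vec (y $ 1) (y $ 2)" using lift by blast
    have "omega n x w \<le> 1" if x: "x \<in> P_ball n" for x
    proof -
      have "x \<in> R2n n" using x by (simp add: P_ball_def)
      then have "omega n x w = det2 (f x) y"
        using symp[of x w] w omega_plane_vec[OF n] by (simp add: f_def)
      then show ?thesis using y x by (auto simp: K_def)
    qed
    then have "w \<in> P_ball n" using w P_ball_self_polar[of n] by (auto simp: omega_polar_def)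
    moreover have "y = f w" by (simp add: f_def w)
    ultimately show ?thesis by (auto simp: K_def)
  qed
  ultimately have "3 \<le> measure lborel K"
    by (intro area_ge_3[OF K sym]) auto
  also have "K = vec2 ` \<phi> ` P_ball n" by (auto simp: K_def f_def)
  also have "measure lborel \<dots> = vol 1 (plane_proj ` \<phi> ` P_ball n)"
    using K(1) by (intro vol_1_plane_proj[symmetric]) (simp add: K_def f_def image_image compact_imp_closed)
  finally show ?thesis .
qed

text \<open>Dropping the tail only relaxes the constraint on |x0 - x1|, and every point of the
  hexagon lies in the ball with zero tail.\<close>

lemma plane_proj_P_ball: "n \<ge> 1 \<Longrightarrow> plane_proj ` P_ball n = P_ball 1"
proof (cases n)
  case (Suc m)
  show ?thesis
  proof (intro set_eqI iffI)
    fix y assume "y \<in> plane_proj ` P_ball n"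
    then obtain x where x: "x \<in> P_ball (Suc m)" "y = plane_proj x" using Suc by auto
    have "tail y = 0" by (simp add: x(2) tail_def plane_proj_def fun_eq_iff)
    moreover have "\<bar>x 0 - x 1\<bar> \<le> 1"
      using x(1) P_norm_nonneg[of m "tail x"] unfolding P_ball_Suc by linarith
    ultimately show "y \<in> P_ball 1"
      using x unfolding One_nat_def P_ball_Suc by (simp add: plane_proj_def)
  next
    fix y assume y: "y \<in> P_ball 1"
    then have "tail y = 0" unfolding One_nat_def P_ball_Suc R2n_0 by blast
    then have "y \<in> P_ball n" using y unfolding Suc One_nat_def P_ball_Suc by simp
    moreover have "y = plane_proj y"
      using \<open>tail y = 0\<close> by (intro vec_eqI[of y]) (simp_all add: plane_proj_def tail_def fun_eq_iff)
    ultimately show "y \<in> plane_proj ` P_ball n" by blast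
  qed
qed simp

lemma c_ZA_P_ball:
  assumes "n \<ge> 1" shows "c_ZA n (P_ball n) = 3"
  unfolding c_ZA_def
proof (rule cInf_eq_minimum)
  have "linear_symplectomorphism n id"
    by (simp add: linear_symplectomorphism_def linear_id)
  moreover have "vol 1 (plane_proj ` id ` P_ball n) = 3"
    \<comment> \<open>The hexagon has area \<open>P_volume 1\<close>, that is 2 (1 + 1/2) =
      3.\<close>
    using plane_proj_P_ball[OF assms] vol_P_ball[of 1] by simp
  ultimately show "3 \<in> (\<lambda>\<phi>. vol 1 (plane_proj ` \<phi> ` P_ball n)) ` {\<phi>. linear_symplectomorphism n \<phi>}"
    by (intro image_eqI[of _ _ id]) auto
qed (use plane_projection_area_ge_3 assms in auto)

theorem theorem3p2:
  fixes n :: nat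
  assumes "n \<ge> 1"
  shows "polytope (P_power n) \<and>
    symplectically_self_polar n (P_power n) \<and>
    vol n (P_power n) =
      2 ^ n / fact n * (Gamma (real n + 3 / 4) / Gamma (real n + 1 / 2))
        * (Gamma (1 / 2) / Gamma (3 / 4)) \<and>
    card (vertices (P_power n)) = 10 * (2 ^ (n - 1) - 1) + 6 \<and>
    c_ZA n (P_power n) = 3"
proof (intro conjI)
  show "polytope (P_power n)"
    unfolding polytope_def P_power_eq_P_ball using P_ball_eq_hull finite_P_vertices by blast
  obtain m where m: "n = Suc m" using assms by (cases n) auto
  have "card (P_vertices n) + 4 = 10 * 2 ^ m" using card_P_vertices[of n] by (simp add: m)
  \<comment> \<open>This makes the subtraction of natural numbers in the vertex count exact.\<close>
  moreover have "(1::nat) \<le> 2 ^ m" by simp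
  ultimately show "card (vertices (P_power n)) = 10 * (2 ^ (n - 1) - 1) + 6"
    unfolding P_power_eq_P_ball vertices_P_ball m diff_Suc_1 by linarith
qed (simp_all only: P_power_eq_P_ball symplectically_self_polar_P_ball vol_P_ball
      P_volume_eq_Gamma c_ZA_P_ball[OF assms])

end
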